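(* Let $\alpha\colon\mathbf{S}^{1}\to\mathbf{R}^{2}$ be a clean, central $C^{2}$ immersed loop. Then either (a) the central symmetry preserves the orientation of $\alpha$, in which case $\alpha$ is regularly homotopic to $\theta\mapsto e^{(2k+1)\mathrm{i}\theta}$ for some $k\in\mathbf{Z}$, avoids its center, and is diameter-central; or (b) the central symmetry reverses the orientation of $\alpha$, in which case $\alpha$ is regularly homotopic to the figure-8 $t\mapsto(\cos t,\sin 2t)$, has a simple double-point at its center, and is not diameter-central.
   Context: An immersed loop $\alpha$ is central with center $\mathbf{c}\in\mathbf{R}^2$ if its image is mapped to itself by the reflection $x\mapsto 2\mathbf{c}-x$. It is clean if, whenever $t_1\neq t_2$ in $\mathbf{S}^1$ are preimages of a single point, they have respective neighborhoods $U_1,U_2$ whose images $\alpha(U_1),\alpha(U_2)$ intersect transversally. A point $p$ in the image is a double-point if $\alpha^{-1}(p)$ contains more than one point, and a simple double-point if $\alpha^{-1}(p)$ contains exactly two points. An immersed loop $\beta$ reparametrizes $\alpha$ if $\beta=\alpha\circ\phi$ for a diffeomorphism $\phi\colon\mathbf{S}^1\to\mathbf{S}^1$; it preserves (reverses) orientation if $\phi$ preserves (reverses) the orientation of the circle. The central symmetry of $\alpha$ preserves (reverses) orientation if the reflected loop $2\mathbf{c}-\alpha$ is an orientation-preserving (orientation-reversing) reparametrization of $\alpha$. With $\mathbf{S}^1\approx\mathbf{R}/2\pi\mathbf{Z}$, $\alpha$ is diameter-central if it can be parametrized so that $2\mathbf{c}-\alpha(t)=\alpha(t+\pi)$ for all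 $t\in\mathbf{S}^1$. The plane $\mathbf{R}^2$ is identified with $\mathbf{C}$. *)

theory Defs
  imports "HOL-Analysis.Analysis" "HOL-Library.Real_Mod"
begin

text \<open>
  The circle is \<open>\<real> / 2\<pi>\<int>\<close>: a loop is a \<open>2\<pi>\<close>-periodic function on the reals, points of the
  circle are reals up to congruence modulo \<open>2\<pi>\<close>, and a map from the circle to itself is given
  by a lift to the reals.  The plane is \<^typ>\<open>complex\<close>.
\<close>

primrec C_k :: "nat \<Rightarrow> (real \<Rightarrow> 'a::real_normed_vector) \<Rightarrow> bool" where
  "C_k 0 = (\<lambda>f. continuous_on UNIV f)"
| "C_k (Suc k) = (\<lambda>f. \<exists>f'. (\<forall>t. (f has_vector_derivative f' t) (at t)) \<and> C_k k f')"

definition immersed_loop :: "nat \<Rightarrow> (real \<Rightarrow> complex) \<Rightarrow> bool" where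
  "immersed_loop k \<alpha> \<longleftrightarrow>
     (\<forall>t. \<alpha> (t + 2 * pi) = \<alpha> t) \<and> C_k k \<alpha> \<and> (\<forall>t. vector_derivative \<alpha> (at t) \<noteq> 0)"

definition central :: "(real \<Rightarrow> complex) \<Rightarrow> complex \<Rightarrow> bool" where
  "central \<alpha> c \<longleftrightarrow> (\<lambda>x. 2 * c - x) ` range \<alpha> = range \<alpha>"

text \<open>
  Transversality of \<open>\<alpha>(U\<^sub>1)\<close> and \<open>\<alpha>(U\<^sub>2)\<close>: at each common point the two tangent
  lines together span the plane over the reals.
\<close>

definition transversal_on :: "(real \<Rightarrow> complex) \<Rightarrow> real set \<Rightarrow> real set \<Rightarrow> bool" where
  "transversal_on \<alpha> U\<^sub>1 U\<^sub>2 \<longleftrightarrow>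
     (\<forall>s\<^sub>1\<in>U\<^sub>1. \<forall>s\<^sub>2\<in>U\<^sub>2. \<alpha> s\<^sub>1 = \<alpha> s\<^sub>2 \<longrightarrow>
        span {vector_derivative \<alpha> (at s\<^sub>1), vector_derivative \<alpha> (at s\<^sub>2)} = UNIV)"

definition clean :: "(real \<Rightarrow> complex) \<Rightarrow> bool" where
  "clean \<alpha> \<longleftrightarrow>
     (\<forall>t\<^sub>1 t\<^sub>2. \<not> [t\<^sub>1 = t\<^sub>2] (rmod (2 * pi)) \<and> \<alpha> t\<^sub>1 = \<alpha> t\<^sub>2 \<longrightarrow>
        (\<exists>U\<^sub>1 U\<^sub>2. open U\<^sub>1 \<and> t\<^sub>1 \<in> U\<^sub>1 \<and> open U\<^sub>2 \<and> t\<^sub>2 \<in> U\<^sub>2 \<and> transversal_on \<alpha> U\<^sub>1 U\<^sub>2))"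

text \<open>
  The interval \<open>[0, 2\<pi>)\<close> contains each point of the circle once, so the cardinality below
  counts preimages on the circle.
\<close>

definition simple_double_point :: "(real \<Rightarrow> complex) \<Rightarrow> complex \<Rightarrow> bool" where
  "simple_double_point \<alpha> p \<longleftrightarrow> card {t \<in> {0..<2 * pi}. \<alpha> t = p} = 2"

text \<open>
  A map \<open>\<phi>\<close> is a lift of a \<open>C\<^sup>k\<close> map of the circle to itself, of degree \<open>d\<close>; it is a lift of a
  diffeomorphism if that map has an inverse of the same kind.
\<close>

definition circle_map :: "nat \<Rightarrow> (real \<Rightarrow> real) \<Rightarrow> bool" where
  "circle_map k \<phi> \<longleftrightarrow> C_k k \<phi> \<and> (\<exists>d::int. \<forall>t. \<phi> (t + 2 * pi) = \<phi> t + 2 * pi * of_int d)"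

definition circle_diffeo :: "nat \<Rightarrow> (real \<Rightarrow> real) \<Rightarrow> bool" where
  "circle_diffeo k \<phi> \<longleftrightarrow>
     circle_map k \<phi> \<and>
     (\<exists>\<psi>. circle_map k \<psi> \<and>
        (\<forall>t. [\<psi> (\<phi> t) = t] (rmod (2 * pi))) \<and> (\<forall>t. [\<phi> (\<psi> t) = t] (rmod (2 * pi))))"

definition preserves_orientation :: "(real \<Rightarrow> real) \<Rightarrow> bool" where
  "preserves_orientation \<phi> \<longleftrightarrow> (\<forall>t. deriv \<phi> t > 0)"

definition reverses_orientation :: "(real \<Rightarrow> real) \<Rightarrow> bool" where
  "reverses_orientation \<phi> \<longleftrightarrow> (\<forall>t. deriv \<phi> t < 0)"

definition reparametrizes :: "nat \<Rightarrow> (real \<Rightarrow> complex) \<Rightarrow> (real \<Rightarrow> complex) \<Rightarrow> bool" where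
  "reparametrizes k \<beta> \<alpha> \<longleftrightarrow> (\<exists>\<phi>. circle_diffeo k \<phi> \<and> \<beta> = \<alpha> \<circ> \<phi>)"

definition symmetry_preserves_orientation :: "nat \<Rightarrow> (real \<Rightarrow> complex) \<Rightarrow> complex \<Rightarrow> bool" where
  "symmetry_preserves_orientation k \<alpha> c \<longleftrightarrow>
     (\<exists>\<phi>. circle_diffeo k \<phi> \<and> preserves_orientation \<phi> \<and> (\<lambda>t. 2 * c - \<alpha> t) = \<alpha> \<circ> \<phi>)"

definition symmetry_reverses_orientation :: "nat \<Rightarrow> (real \<Rightarrow> complex) \<Rightarrow> complex \<Rightarrow> bool" where
  "symmetry_reverses_orientation k \<alpha> c \<longleftrightarrow>
     (\<exists>\<phi>. circle_diffeo k \<phi> \<and> reverses_orientation \<phi> \<and> (\<lambda>t. 2 * c - \<alpha> t) = \<alpha> \<circ> \<phi>)"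

definition diameter_central :: "nat \<Rightarrow> (real \<Rightarrow> complex) \<Rightarrow> complex \<Rightarrow> bool" where
  "diameter_central k \<alpha> c \<longleftrightarrow>
     (\<exists>\<beta>. reparametrizes k \<beta> \<alpha> \<and> (\<forall>t. 2 * c - \<beta> t = \<beta> (t + pi)))"

text \<open>
  Regular homotopy in the sense of Whitney: a homotopy \<open>H\<close> through \<open>C\<^sup>1\<close> immersed loops whose
  velocity \<open>\<partial>H/\<partial>t\<close> is continuous in both variables.
\<close>

definition regularly_homotopic :: "(real \<Rightarrow> complex) \<Rightarrow> (real \<Rightarrow> complex) \<Rightarrow> bool" where
  "regularly_homotopic \<alpha> \<beta> \<longleftrightarrow>
     (\<exists>H :: real \<Rightarrow> real \<Rightarrow> complex.
        H 0 = \<alpha> \<and> H 1 = \<beta> \<and>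
        (\<forall>s\<in>{0..1}. immersed_loop 1 (H s)) \<and>
        continuous_on ({0..1} \<times> UNIV) (\<lambda>(s, t). H s t) \<and>
        continuous_on ({0..1} \<times> UNIV) (\<lambda>(s, t). vector_derivative (H s) (at t)))"

definition figure_eight :: "real \<Rightarrow> complex" where
  "figure_eight t = Complex (cos t) (sin (2 * t))"

end

theory Submission
  imports Defs
begin

text \<open>
  Write \<open>\<beta> = 2c - \<alpha>\<close> for the reflected loop. Since \<open>\<beta>\<close> runs inside the image of \<open>\<alpha>\<close>, at every
  parameter \<open>t\<close> some branch of \<open>\<alpha>\<close> passes through \<open>\<beta> t\<close> in the direction of \<open>\<beta>\<close>, and since
  distinct branches of a clean loop are transversal, there is only one such branch. Its parameter
  \<open>\<phi> t\<close> therefore depends continuously on \<open>t\<close> (\<open>ex_continuous_tangent_parameter\<close>), and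
  comparing increments of \<open>\<alpha>\<close> and \<open>\<beta>\<close> shows that \<open>\<phi>\<close> is \<open>C\<^sup>2\<close> with nowhere vanishing
  derivative. The same uniqueness makes \<open>\<phi>\<close> an involution of the circle, hence a diffeomorphism
  with \<open>2c - \<alpha> = \<alpha> \<circ> \<phi>\<close> (\<open>ex_reflecting_diffeo\<close>). It determines all such maps up to full turns,
  so exactly one of the two orientation cases occurs, according to the sign of \<open>\<phi>'\<close>.

  If \<open>\<phi>\<close> is increasing, it has degree \<open>1\<close>, and a suitable lift satisfies
  \<open>\<phi> (\<phi> t) = t + 2\<pi>\<close>: the alternative \<open>\<phi> (\<phi> t) = t\<close> would make \<open>\<phi>\<close> the identity and \<open>\<alpha>\<close>
  constant. Then \<open>h t = (t + \<phi> t - \<pi>) / 2\<close> is a coordinate on the circle in which \<open>\<phi>\<close> is the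
  translation by \<open>\<pi>\<close>, so \<open>\<alpha>\<close> is diameter-central. A diameter-central clean loop avoids its center,
  because it would pass there twice with opposite velocities. A tangent angle \<open>\<theta>\<close> changes by an
  odd multiple of \<open>\<pi>\<close> from \<open>t\<close> to \<open>\<phi> t\<close>; doing this twice shows that the turning number is odd.

  If \<open>\<phi>\<close> is decreasing, it has degree \<open>-1\<close> and exactly two fixed points on the circle; these are
  the preimages of the center. The reflection turns velocities around and \<open>\<phi>\<close> reverses them
  once more, so \<open>\<theta> \<circ> \<phi>\<close> and \<open>\<theta>\<close> differ by a constant; as \<open>\<phi>\<close> traverses the circle backwards, the
  turning number is its own negative, that is, zero. The figure-8 has the same kind of symmetry,
  and with it turning number zero.

  The regular homotopies then come from the Whitney--Graustein theorem
  (\<open>same_turning_number_imp_regularly_homotopic\<close>).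
\<close>

section \<open>Calculus on the circle\<close>

abbreviation velocity :: "(real \<Rightarrow> complex) \<Rightarrow> real \<Rightarrow> complex" where
  "velocity \<alpha> t \<equiv> vector_derivative \<alpha> (at t)"

lemma congruent_continuous_imp_differ_by_constant:
  fixes f g :: "real \<Rightarrow> real"
  assumes f: "continuous_on UNIV f" and g: "continuous_on UNIV g"
    and cong: "\<And>t. [f t = g t] (rmod (2 * pi))"
  obtains n :: int where "\<And>t. g t = f t + 2 * pi * of_int n"
proof -
  define h where "h t = (g t - f t) / (2 * pi)" for t
  have int: "\<exists>n::int. h t = of_int n" for t
    using cong[of t] by (auto simp: rcong_altdef h_def)
  have "h constant_on UNIV"
  proof (rule continuous_discrete_range_constant)
    show "continuous_on UNIV h"
      unfolding h_def by (intro continuous_intros f g) auto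
    show "\<exists>e>0. \<forall>y. y \<in> UNIV \<and> h y \<noteq> h x \<longrightarrow> e \<le> norm (h y - h x)" for x
    proof (intro exI[of _ 1] conjI allI impI)
      fix y assume ne: "y \<in> UNIV \<and> h y \<noteq> h x"
      obtain m n :: int where m: "h y = of_int m" and n: "h x = of_int n"
        using int by metis
      with ne have "1 \<le> \<bar>m - n\<bar>" by auto
      then have "1 \<le> \<bar>real_of_int (m - n)\<bar>" by linarith
      then show "1 \<le> norm (h y - h x)" by (simp add: m n)
    qed simp
  qed simp
  then obtain a where a: "\<And>t. h t = a"
    by (auto simp: constant_on_def)
  obtain n :: int where "h 0 = of_int n" using int by blast
  then have "g t = f t + 2 * pi * of_int n" for t
    using a[of t] a[of 0] by (simp add: h_def field_simps)
  then show ?thesis by (rule that)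
qed

lemma periodic_shift:
  assumes "\<And>t::real. f (t + 2 * pi) = f t"
  shows "f (t + 2 * pi * of_int n) = f t"
proof -
  have nat: "f (t + 2 * pi * of_nat m) = f t" for m t
  proof (induction m)
    case (Suc m)
    have "t + 2 * pi * of_nat (Suc m) = (t + 2 * pi * of_nat m) + 2 * pi"
      by (simp add: algebra_simps)
    then show ?case using Suc assms by metis
  qed simp
  show ?thesis
  proof (cases "n \<ge> 0")
    case True
    then show ?thesis using nat[of t "nat n"] by simp
  next
    case False
    then show ?thesis using nat[of "t + 2 * pi * of_int n" "nat (- n)"] by simp
  qed
qed

lemma periodic_cong:
  assumes "\<And>t::real. f (t + 2 * pi) = f t" and "[s = t] (rmod (2 * pi))"
  shows "f s = f t"
  using assms(2) periodic_shift[of f, OF assms(1)]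
  by (auto simp: rcong_altdef mult.commute)

lemma representative_in_period:
  fixes x :: real
  obtains s where "s \<in> {0..<2 * pi}" "[s = x] (rmod (2 * pi))"
proof
  show "x rmod (2 * pi) \<in> {0..<2 * pi}"
    using rmod_nonneg[of "2 * pi" x] rmod_less[of "2 * pi" x] by simp
  show "[x rmod (2 * pi) = x] (rmod (2 * pi))"
    by (intro rcong_intros)
qed

lemma C_k_1_iff:
  "C_k 1 f \<longleftrightarrow> (\<exists>f'. (\<forall>t. (f has_vector_derivative f' t) (at t)) \<and> continuous_on UNIV f')"
  by simp

lemma C_k_2_iff:
  "C_k 2 f \<longleftrightarrow> (\<exists>f' f''. (\<forall>t. (f has_vector_derivative f' t) (at t)) \<and>
      (\<forall>t. (f' has_vector_derivative f'' t) (at t)) \<and> continuous_on UNIV f'')"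
  unfolding numeral_2_eq_2 by auto

lemma continuous_on_if_has_vector_derivative:
  fixes f :: "real \<Rightarrow> 'a::real_normed_vector"
  assumes "\<And>t. (f has_vector_derivative f' t) (at t)"
  shows "continuous_on UNIV f"
  using assms by (auto simp: continuous_on_eq_continuous_within intro: has_vector_derivative_continuous)

lemma C_k_imp_continuous: "C_k k f \<Longrightarrow> continuous_on UNIV f"
  by (cases k) (auto intro: continuous_on_if_has_vector_derivative)

lemma C_k_2_imp_C_k_1: "C_k 2 f \<Longrightarrow> C_k 1 f"
  unfolding C_k_1_iff C_k_2_iff by (metis continuous_on_if_has_vector_derivative)

lemma C_k_1_real_iff:
  "C_k 1 f \<longleftrightarrow> (\<exists>f'. (\<forall>t. (f has_real_derivative f' t) (at t)) \<and> continuous_on UNIV f')"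
  by (simp add: has_real_derivative_iff_has_vector_derivative)

lemma C_k_1_realI:
  assumes "\<And>t. (f has_real_derivative f' t) (at t)" "continuous_on UNIV f'"
  shows "C_k 1 f"
  using assms unfolding C_k_1_real_iff by blast

lemma C_k_1_Re_divide:
  fixes f g :: "real \<Rightarrow> complex"
  assumes "C_k 1 f" "C_k 1 g" "\<And>t. g t \<noteq> 0"
  shows "C_k 1 (\<lambda>t. Re (f t / g t))"
proof -
  obtain f' where f': "\<And>t. (f has_vector_derivative f' t) (at t)" "continuous_on UNIV f'"
    using assms(1) unfolding C_k_1_iff by blast
  obtain g' where g': "\<And>t. (g has_vector_derivative g' t) (at t)" "continuous_on UNIV g'"
    using assms(2) unfolding C_k_1_iff by blast
  have D: "((\<lambda>t. Re (f t)) has_real_derivative Re (f' t)) (at t)"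
    "((\<lambda>t. Im (f t)) has_real_derivative Im (f' t)) (at t)"
    "((\<lambda>t. Re (g t)) has_real_derivative Re (g' t)) (at t)"
    "((\<lambda>t. Im (g t)) has_real_derivative Im (g' t)) (at t)" for t
    using f'(1)[of t] g'(1)[of t] by (simp_all add: has_vector_derivative_complex_iff)
  define N where "N t = Re (f t) * Re (g t) + Im (f t) * Im (g t)" for t
  define N' where "N' t = Re (f t) * Re (g' t) + Re (f' t) * Re (g t)
    + (Im (f t) * Im (g' t) + Im (f' t) * Im (g t))" for t
  define M where "M t = Re (g t) * Re (g t) + Im (g t) * Im (g t)" for t
  define M' where "M' t = Re (g t) * Re (g' t) + Re (g' t) * Re (g t)
    + (Im (g t) * Im (g' t) + Im (g' t) * Im (g t))" for t
  have nz: "M t \<noteq> 0" for t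
    using assms(3)[of t] by (simp add: M_def complex_eq_iff sum_squares_eq_zero_iff)
  have N: "(N has_real_derivative N' t) (at t)" and M: "(M has_real_derivative M' t) (at t)" for t
    unfolding N_def N'_def M_def M'_def
    by (rule DERIV_cong[OF DERIV_add[OF DERIV_mult[OF D(1,3)] DERIV_mult[OF D(2,4)]]]
          DERIV_cong[OF DERIV_add[OF DERIV_mult[OF D(3,3)] DERIV_mult[OF D(4,4)]]];
        simp add: algebra_simps)+
  have "(\<lambda>t. Re (f t / g t)) = (\<lambda>t. N t / M t)"
    by (simp add: Re_divide N_def M_def power2_eq_square)
  moreover have "((\<lambda>t. N t / M t) has_real_derivative (N' t * M t - N t * M' t) / (M t * M t)) (at t)" for t
    by (rule DERIV_divide[OF N M nz])
  moreover have "continuous_on UNIV (\<lambda>t. (N' t * M t - N t * M' t) / (M t * M t))"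
  proof -
    have cf: "continuous_on UNIV f" "continuous_on UNIV g"
      using f'(1) g'(1) by (auto intro: continuous_on_if_has_vector_derivative)
    show ?thesis
      using nz unfolding N_def N'_def M_def M'_def
      by (intro continuous_intros cf f'(2) g'(2)) auto
  qed
  ultimately show ?thesis
    using C_k_1_realI by (metis (no_types, lifting))
qed

lemma C_k_1_compose:
  fixes f :: "real \<Rightarrow> 'a::real_normed_vector" and g :: "real \<Rightarrow> real"
  assumes "C_k 1 f" "C_k 1 g"
  shows "C_k 1 (\<lambda>t. f (g t))"
proof -
  obtain f' where f': "\<And>t. (f has_vector_derivative f' t) (at t)" "continuous_on UNIV f'"
    using assms(1) unfolding C_k_1_iff by blast
  obtain g' where g': "\<And>t. (g has_vector_derivative g' t) (at t)" "continuous_on UNIV g'"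
    using assms(2) unfolding C_k_1_iff by blast
  have "((\<lambda>t. f (g t)) has_vector_derivative g' t *\<^sub>R f' (g t)) (at t)" for t
    using vector_diff_chain_at[OF g'(1)[of t] f'(1)[of "g t"]] by (simp add: o_def)
  moreover have "continuous_on UNIV (\<lambda>t. g' t *\<^sub>R f' (g t))"
    by (intro continuous_intros g'(2) continuous_on_compose2[OF f'(2)] C_k_imp_continuous[OF assms(2)]) auto
  ultimately show ?thesis
    unfolding C_k_1_iff by (intro exI[of _ "\<lambda>t. g' t *\<^sub>R f' (g t)"]) auto
qed

lemma C_k_2I:
  assumes "\<And>t. (f has_vector_derivative f' t) (at t)" "C_k 1 f'"
  shows "C_k 2 f"
  using assms unfolding numeral_2_eq_2 C_k.simps(2)[of "Suc 0"] by auto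

lemma C_k_2E:
  assumes "C_k 2 f"
  obtains f' where "\<And>t. (f has_vector_derivative f' t) (at t)" "C_k 1 f'"
  using assms unfolding numeral_2_eq_2 C_k.simps(2)[of "Suc 0"] by auto

lemma immersed_loop_2_imp_1: "immersed_loop 2 \<alpha> \<Longrightarrow> immersed_loop 1 \<alpha>"
  unfolding immersed_loop_def using C_k_2_imp_C_k_1 by blast

lemma has_velocity:
  assumes "immersed_loop 1 \<alpha>"
  shows "(\<alpha> has_vector_derivative velocity \<alpha> t) (at t)"
  using assms unfolding immersed_loop_def C_k_1_iff by (metis vector_derivative_at)

lemma continuous_velocity:
  assumes "immersed_loop 1 \<alpha>"
  shows "continuous_on UNIV (velocity \<alpha>)"
proof -
  obtain a where a: "\<And>t. (\<alpha> has_vector_derivative a t) (at t)" and c: "continuous_on UNIV a"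
    using assms unfolding immersed_loop_def C_k_1_iff by blast
  have "velocity \<alpha> t = a t" for t
    using a by (rule vector_derivative_at)
  then show ?thesis using c continuous_on_cong[of UNIV UNIV "velocity \<alpha>" a] by blast
qed

lemma continuous_loop:
  assumes "immersed_loop 1 \<alpha>"
  shows "continuous_on UNIV \<alpha>"
  using has_velocity[OF assms] by (rule continuous_on_if_has_vector_derivative)

lemma velocity_nonzero: "immersed_loop k \<alpha> \<Longrightarrow> velocity \<alpha> t \<noteq> 0"
  by (simp add: immersed_loop_def)

lemma loop_periodic: "immersed_loop k \<alpha> \<Longrightarrow> \<alpha> (t + 2 * pi) = \<alpha> t"
  by (simp add: immersed_loop_def)

lemma velocity_periodic:
  assumes "immersed_loop 1 \<alpha>"
  shows "velocity \<alpha> (t + 2 * pi) = velocity \<alpha> t"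
proof -
  have "((\<alpha> \<circ> (\<lambda>t. t + 2 * pi)) has_vector_derivative (1 *\<^sub>R velocity \<alpha> (t + 2 * pi))) (at t)"
    by (rule vector_diff_chain_at) (auto intro!: derivative_eq_intros has_velocity assms)
  moreover have "\<alpha> \<circ> (\<lambda>t. t + 2 * pi) = \<alpha>"
    using assms by (auto simp: loop_periodic)
  ultimately show ?thesis
    using vector_derivative_at by fastforce
qed

lemma difference_quotient_tendsto:
  fixes f :: "real \<Rightarrow> complex"
  assumes "(f has_vector_derivative f') (at t)"
  shows "((\<lambda>x. (f x - f t) / of_real (x - t)) \<longlongrightarrow> f') (at t)"
  using assms unfolding has_vector_derivative_complex_iff has_field_derivative_iff tendsto_complex_iff
  by (simp add: Re_divide_of_real Im_divide_of_real del: of_real_diff)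

text \<open>
  If \<open>\<alpha>\<close> and \<open>\<beta>\<close> pass through the same points at the parameters \<open>v\<close> and \<open>u\<close>, the increments of
  \<open>v\<close> and \<open>u\<close> are related by the two velocities. This both forces the velocities at the limit
  to be parallel, because the ratio of the increments is real, and differentiates \<open>v\<close> as a
  function of \<open>u\<close>.
\<close>

lemma increment_ratio_tendsto:
  fixes \<alpha> \<beta> :: "real \<Rightarrow> complex"
  assumes \<alpha>: "(\<alpha> has_vector_derivative a) (at s)" and a: "a \<noteq> 0"
    and \<beta>: "(\<beta> has_vector_derivative b) (at t)" and eq: "\<alpha> s = \<beta> t"
    and u: "(u \<longlongrightarrow> t) F" "eventually (\<lambda>x. u x \<noteq> t) F"
    and v: "(v \<longlongrightarrow> s) F" "eventually (\<lambda>x. \<alpha> (v x) = \<beta> (u x)) F"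
  shows "((\<lambda>x. complex_of_real ((v x - s) / (u x - t))) \<longlongrightarrow> b / a) F"
proof -
  \<comment> \<open>Since \<open>v\<close> may hit \<open>s\<close>, the difference quotient of \<open>\<alpha>\<close> is extended continuously to \<open>s\<close>.\<close>
  define A where "A x = (if x = s then a else (\<alpha> x - \<alpha> s) / of_real (x - s))" for x
  have "(A \<longlongrightarrow> a) (at s)"
    using difference_quotient_tendsto[OF \<alpha>]
    by (rule Lim_transform_eventually) (auto simp: A_def eventually_at_filter)
  then have "isCont A s"
    by (simp add: isCont_def A_def)
  then have A: "((\<lambda>x. A (v x)) \<longlongrightarrow> a) F"
    using isCont_tendsto_compose[OF _ v(1)] by (fastforce simp: A_def)
  have B: "((\<lambda>x. (\<beta> (u x) - \<beta> t) / of_real (u x - t)) \<longlongrightarrow> b) F"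
    by (rule filterlim_compose[OF difference_quotient_tendsto[OF \<beta>]])
      (use u in \<open>simp add: filterlim_at\<close>)
  have "eventually (\<lambda>x. A (v x) \<noteq> 0) F"
    using A a by (rule tendsto_imp_eventually_ne)
  then have "eventually (\<lambda>x. (\<beta> (u x) - \<beta> t) / of_real (u x - t) / A (v x)
      = complex_of_real ((v x - s) / (u x - t))) F"
    using u(2) v(2)
  proof eventually_elim
    case (elim x)
    have "\<alpha> (v x) - \<alpha> s = of_real (v x - s) * A (v x)"
      by (simp add: A_def)
    with elim eq show ?case by (simp add: field_simps del: of_real_diff)
  qed
  then show ?thesis
    by (rule Lim_transform_eventually[OF tendsto_divide[OF B A a]])
qed

lemma increment_ratio_real_limit:
  fixes \<alpha> \<beta> :: "real \<Rightarrow> complex"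
  assumes "(\<alpha> has_vector_derivative a) (at s)" "a \<noteq> 0"
    "(\<beta> has_vector_derivative b) (at t)" "\<alpha> s = \<beta> t"
    "(u \<longlongrightarrow> t) F" "eventually (\<lambda>x. u x \<noteq> t) F"
    "(v \<longlongrightarrow> s) F" "eventually (\<lambda>x. \<alpha> (v x) = \<beta> (u x)) F" "F \<noteq> bot"
  shows "b / a \<in> \<real>" "((\<lambda>x. (v x - s) / (u x - t)) \<longlongrightarrow> Re (b / a)) F"
proof -
  note lim = increment_ratio_tendsto[OF assms(1-8)]
  show "b / a \<in> \<real>"
    using lim by (rule Lim_in_closed_set[OF closed_complex_Reals _ assms(9), rotated]) (auto simp del: of_real_divide of_real_diff)
  show "((\<lambda>x. (v x - s) / (u x - t)) \<longlongrightarrow> Re (b / a)) F"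
    using tendsto_Re[OF lim] by (simp del: of_real_divide of_real_diff)
qed

lemma C_k_velocity:
  assumes "immersed_loop 2 \<alpha>"
  shows "C_k 1 (velocity \<alpha>)"
proof -
  obtain a where a: "\<And>t. (\<alpha> has_vector_derivative a t) (at t)" "C_k 1 a"
    using assms C_k_2E unfolding immersed_loop_def by metis
  have "a = velocity \<alpha>" using vector_derivative_at[OF a(1)] by auto
  then show ?thesis using a(2) by metis
qed

lemma continuous_nonzero_sign:
  fixes f :: "real \<Rightarrow> real"
  assumes "continuous_on UNIV f" "\<And>t. f t \<noteq> 0"
  shows "(\<forall>t. f t > 0) \<or> (\<forall>t. f t < 0)"
proof (rule ccontr)
  assume "\<not> ?thesis"
  then obtain s t where st: "f s \<le> 0" "0 \<le> f t"
    by (meson not_less)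
  have "connected (range f)"
    by (rule connected_continuous_image[OF assms(1) connected_UNIV])
  then have "0 \<in> range f"
    using st unfolding connected_iff_interval by blast
  then show False using assms(2) by (metis rangeE)
qed

lemma circle_map_shift:
  assumes d: "\<And>t. \<phi> (t + 2 * pi) = \<phi> t + 2 * pi * of_int d"
  shows "\<phi> (t + 2 * pi * of_int n) = \<phi> t + 2 * pi * of_int (d * n)"
proof -
  have "(\<lambda>t. \<phi> t - of_int d * t) (t + 2 * pi * of_int n) = (\<lambda>t. \<phi> t - of_int d * t) t"
    by (rule periodic_shift) (unfold d, simp add: algebra_simps)
  then show ?thesis by (simp add: algebra_simps)
qed

text \<open>
  Degrees multiply under composition, and a lift of the identity has degree \<open>1\<close>.
\<close>

lemma circle_map_compose_self_degree:
  assumes d: "\<And>t. \<phi> (t + 2 * pi) = \<phi> t + 2 * pi * of_int d"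
    and m: "\<And>t. \<phi> (\<phi> t) = t + 2 * pi * of_int m"
  shows "d = 1 \<or> d = - 1"
proof -
  have "2 * pi * of_int (d * d) = 2 * pi"
    using m[of "0 + 2 * pi"] m[of 0] d[of 0] circle_map_shift[of \<phi> d, OF d, of "\<phi> 0" d] by simp
  then have "real_of_int (d * d) = 1" by simp
  then have "d * d = 1" by linarith
  then show ?thesis using zmult_eq_1_iff by metis
qed

section \<open>Matching a loop with the tangents of a clean loop\<close>

text \<open>
  The neighborhoods in the definition of cleanness contain the two preimages themselves, so the
  velocities there span the plane. This is the form in which cleanness enters everywhere below.
\<close>

lemma clean_parallel_imp_same_parameter:
  assumes "clean \<alpha>" and eq: "\<alpha> s = \<alpha> t" and par: "velocity \<alpha> s / velocity \<alpha> t \<in> \<real>"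
    and nz: "velocity \<alpha> t \<noteq> 0"
  shows "[s = t] (rmod (2 * pi))"
proof (rule ccontr)
  assume "\<not> [s = t] (rmod (2 * pi))"
  then have full: "span {velocity \<alpha> s, velocity \<alpha> t} = (UNIV :: complex set)"
    using assms(1) eq unfolding clean_def transversal_on_def by metis
  obtain r where "velocity \<alpha> s / velocity \<alpha> t = of_real r"
    using par by (auto elim: Reals_cases)
  then have "velocity \<alpha> s = r *\<^sub>R velocity \<alpha> t"
    using nz by (simp add: field_simps scaleR_conv_of_real)
  then have "velocity \<alpha> s \<in> span {velocity \<alpha> t}"
    by (simp add: span_scale span_base)
  with full have "span {velocity \<alpha> t} = (UNIV :: complex set)"
    by (metis span_redundant)
  then have "DIM(complex) \<le> card {velocity \<alpha> t}"
    by (metis dim_UNIV dim_le_card finite.emptyI finite.insertI order_refl span_superset dim_span)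
  then show False by simp
qed

lemma clean_tangent_parameter_unique:
  assumes "clean \<alpha>" "immersed_loop k \<alpha>" "\<alpha> s = \<alpha> s'"
    and "b / velocity \<alpha> s \<in> \<real>" "b / velocity \<alpha> s' \<in> \<real>" "b \<noteq> 0"
  shows "[s = s'] (rmod (2 * pi))"
proof (rule clean_parallel_imp_same_parameter[OF assms(1,3)])
  have "(b / velocity \<alpha> s') / (b / velocity \<alpha> s) \<in> \<real>"
    by (rule Reals_divide[OF assms(5,4)])
  then show "velocity \<alpha> s / velocity \<alpha> s' \<in> \<real>"
    using assms(6) by (simp add: field_simps)
qed (use velocity_nonzero[OF assms(2)] in auto)

text \<open>
  Approach \<open>\<beta> t\<close> along \<open>\<beta>\<close> itself: the nearby points have preimages under \<open>\<alpha>\<close>, and a limit of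
  those preimages is a parameter at which \<open>\<alpha>\<close> is tangent to \<open>\<beta>\<close>.
\<close>

lemma ex_tangent_parameter:
  assumes \<alpha>: "immersed_loop 1 \<alpha>" and \<beta>: "immersed_loop 1 \<beta>" and sub: "range \<beta> \<subseteq> range \<alpha>"
  shows "\<exists>s\<in>{0..2 * pi}. \<alpha> s = \<beta> t \<and> velocity \<beta> t / velocity \<alpha> s \<in> \<real>"
proof -
  define u where "u n = t + inverse (real (Suc n))" for n
  have "\<exists>s\<in>{0..2 * pi}. \<alpha> s = \<beta> x" for x
  proof -
    obtain y where "\<beta> x = \<alpha> y" using sub by blast
    moreover obtain s where "s \<in> {0..<2 * pi}" "[s = y] (rmod (2 * pi))"
      by (rule representative_in_period)
    ultimately show ?thesis
      using periodic_cong[of \<alpha> s y] loop_periodic[OF \<alpha>] by (intro bexI[of _ s]) auto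
  qed
  then have "\<forall>n. \<exists>s. s \<in> {0..2 * pi} \<and> \<alpha> s = \<beta> (u n)"
    by blast
  then obtain v where v: "\<And>n. v n \<in> {0..2 * pi}" "\<And>n. \<alpha> (v n) = \<beta> (u n)"
    by metis
  obtain s r where s: "s \<in> {0..2 * pi}" and r: "strict_mono r" "(v \<circ> r) \<longlonglongrightarrow> s"
    using compact_Icc[of 0 "2 * pi"] v(1) unfolding compact_def by metis
  have "u \<longlonglongrightarrow> t + 0"
    unfolding u_def by (intro tendsto_intros LIMSEQ_inverse_real_of_nat)
  then have u: "(u \<circ> r) \<longlonglongrightarrow> t"
    using LIMSEQ_subseq_LIMSEQ[OF _ r(1)] by simp
  have "isCont \<alpha> s" "isCont \<beta> t"
    using has_velocity[OF \<alpha>] has_velocity[OF \<beta>] by (auto intro: has_vector_derivative_continuous)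
  then have "(\<lambda>n. \<alpha> ((v \<circ> r) n)) \<longlonglongrightarrow> \<alpha> s" "(\<lambda>n. \<beta> ((u \<circ> r) n)) \<longlonglongrightarrow> \<beta> t"
    using isCont_tendsto_compose r(2) u by blast+
  then have eq: "\<alpha> s = \<beta> t"
    using LIMSEQ_unique v(2) by fastforce
  have "velocity \<beta> t / velocity \<alpha> s \<in> \<real>"
    by (rule increment_ratio_real_limit(1)[OF has_velocity[OF \<alpha>] velocity_nonzero[OF \<alpha>]
          has_velocity[OF \<beta>] eq u _ r(2)])
      (auto simp: v(2) u_def)
  with s eq show ?thesis by blast
qed

text \<open>
  The tangent parameter is unique on the circle, so it is a function with values in the circle
  whose graph is closed; such a function is continuous and lifts to the line.
\<close>

lemma ex_continuous_tangent_parameter: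
  assumes \<alpha>: "immersed_loop 1 \<alpha>" and cl: "clean \<alpha>"
    and \<beta>: "immersed_loop 1 \<beta>" and sub: "range \<beta> \<subseteq> range \<alpha>"
  obtains \<phi> where "continuous_on UNIV \<phi>" "\<And>t. \<alpha> (\<phi> t) = \<beta> t"
    "\<And>t. velocity \<beta> t / velocity \<alpha> (\<phi> t) \<in> \<real>"
proof -
  define P where "P t s \<longleftrightarrow> \<alpha> s = \<beta> t \<and> velocity \<beta> t / velocity \<alpha> s \<in> \<real>" for t s
  obtain \<sigma> where \<sigma>: "\<And>t. \<sigma> t \<in> {0..2 * pi}" "\<And>t. P t (\<sigma> t)"
    unfolding P_def using ex_tangent_parameter[OF \<alpha> \<beta> sub] by metis
  have unique: "[s = s'] (rmod (2 * pi))" if "P t s" "P t s'" for t s s'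
    using clean_tangent_parameter_unique[OF cl \<alpha>, of s s'] velocity_nonzero[OF \<beta>, of t] that
    by (auto simp: P_def)
  define z where "z t = cis (\<sigma> t)" for t
  \<comment> \<open>The graph of the tangent parameter, as a point of the circle, is the projection of \<open>S\<close> along
    the compact interval of representatives.\<close>
  define S where "S = {(s, t, w). \<alpha> s = \<beta> t \<and> Im (velocity \<beta> t / velocity \<alpha> s) = 0 \<and> w = cis s}"
  have "closed S"
  proof -
    have 1: "continuous_on UNIV (\<lambda>x :: real \<times> real \<times> complex. \<alpha> (fst x))"
      "continuous_on UNIV (\<lambda>x :: real \<times> real \<times> complex. \<beta> (fst (snd x)))"
      "continuous_on UNIV (\<lambda>x :: real \<times> real \<times> complex. velocity \<alpha> (fst x))"
      "continuous_on UNIV (\<lambda>x :: real \<times> real \<times> complex. velocity \<beta> (fst (snd x)))"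
      by (rule continuous_on_compose2[OF continuous_loop[OF \<alpha>]]
               continuous_on_compose2[OF continuous_loop[OF \<beta>]]
               continuous_on_compose2[OF continuous_velocity[OF \<alpha>]]
               continuous_on_compose2[OF continuous_velocity[OF \<beta>]];
          auto intro!: continuous_intros)+
    have "S = {x. \<alpha> (fst x) = \<beta> (fst (snd x))} \<inter>
        {x. Im (velocity \<beta> (fst (snd x)) / velocity \<alpha> (fst x)) = 0} \<inter>
        {x. snd (snd x) = cis (fst x)}"
      by (auto simp: S_def)
    also have "closed \<dots>"
      by (intro closed_Int closed_Collect_eq continuous_intros 1 velocity_nonzero[OF \<alpha>])
         (auto simp: velocity_nonzero[OF \<alpha>])
    finally show ?thesis .
  qed
  have "(\<lambda>t. (t, z t)) ` UNIV = {y. \<exists>s. s \<in> {0..2 * pi} \<and> (s, y) \<in> S}"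
  proof (intro set_eqI iffI)
    fix y assume "y \<in> (\<lambda>t. (t, z t)) ` UNIV"
    then obtain t where "y = (t, z t)" by blast
    then show "y \<in> {y. \<exists>s. s \<in> {0..2 * pi} \<and> (s, y) \<in> S}"
      using \<sigma>[of t] by (auto simp: S_def z_def P_def complex_is_Real_iff intro!: exI[of _ "\<sigma> t"])
  next
    fix y assume "y \<in> {y. \<exists>s. s \<in> {0..2 * pi} \<and> (s, y) \<in> S}"
    then obtain s t w where y: "y = (t, w)" and "w = cis s" "P t s"
      by (cases y) (auto simp: S_def P_def complex_is_Real_iff)
    moreover have "cis s = z t"
      unfolding z_def cis_eq_iff using unique[OF \<open>P t s\<close> \<sigma>(2)] .
    ultimately show "y \<in> (\<lambda>t. (t, z t)) ` UNIV" by auto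
  qed
  then have "closed ((\<lambda>t. (t, z t)) ` UNIV)"
    using closed_compact_projection[OF compact_Icc \<open>closed S\<close>] by simp
  then have "continuous_on UNIV z"
    by (subst continuous_closed_graph_eq[of "sphere 0 1"])
       (auto simp: z_def intro!: closed_subset)
  then obtain g where g: "continuous_on UNIV g" "\<And>t. z t = exp (g t)"
    using continuous_logarithm_on_contractible[of UNIV z] by (auto simp: z_def)
  define \<phi> where "\<phi> t = Im (g t)" for t
  have "Re (g t) = 0" for t
    using g(2)[of t] norm_cis[of "\<sigma> t"] by (simp add: z_def norm_exp_eq_Re)
  then have "cis (\<phi> t) = z t" for t
    by (simp add: g(2) exp_eq_polar \<phi>_def)
  then have cong: "[\<sigma> t = \<phi> t] (rmod (2 * pi))" for t
    by (simp add: z_def cis_eq_iff[symmetric])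
  have "P t (\<phi> t)" for t
    using \<sigma>(2)[of t] periodic_cong[OF _ cong, of \<alpha> t] periodic_cong[OF _ cong, of "velocity \<alpha>" t]
    by (simp add: P_def loop_periodic[OF \<alpha>] velocity_periodic[OF \<alpha>])
  moreover have "continuous_on UNIV \<phi>"
    unfolding \<phi>_def by (intro continuous_intros g)
  ultimately show ?thesis
    using that[of \<phi>] by (auto simp: P_def)
qed

section \<open>Turning number and regular homotopy\<close>

definition tangent_angle :: "(real \<Rightarrow> complex) \<Rightarrow> (real \<Rightarrow> real) \<Rightarrow> bool" where
  "tangent_angle \<alpha> \<theta> \<longleftrightarrow> continuous_on UNIV \<theta> \<and> (\<forall>t. sgn (velocity \<alpha> t) = cis (\<theta> t))"

definition has_turning_number :: "(real \<Rightarrow> complex) \<Rightarrow> int \<Rightarrow> bool" where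
  "has_turning_number \<alpha> n \<longleftrightarrow>
     (\<exists>\<theta>. tangent_angle \<alpha> \<theta> \<and> (\<forall>t. \<theta> (t + 2 * pi) = \<theta> t + 2 * pi * of_int n))"

lemma velocity_eq_speed_times_angle:
  assumes "tangent_angle \<alpha> \<theta>"
  shows "velocity \<alpha> t = of_real (norm (velocity \<alpha> t)) * cis (\<theta> t)"
proof -
  have "z = of_real (norm z) * sgn z" for z :: complex
    by (cases "z = 0") (simp_all add: sgn_eq)
  then show ?thesis
    using assms by (metis tangent_angle_def)
qed

lemma ex_turning_number:
  assumes \<alpha>: "immersed_loop 1 \<alpha>"
  shows "\<exists>n. has_turning_number \<alpha> n"
proof -
  obtain g where g: "continuous_on UNIV g" "\<And>t. velocity \<alpha> t = exp (g t)"
    using continuous_logarithm_on_contractible[OF continuous_velocity[OF \<alpha>]] velocity_nonzero[OF \<alpha>]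
    by (metis UNIV_I contractible_UNIV)
  define \<theta> where "\<theta> t = Im (g t)" for t
  have cont: "continuous_on UNIV \<theta>"
    unfolding \<theta>_def by (intro continuous_intros g)
  have angle: "sgn (velocity \<alpha> t) = cis (\<theta> t)" for t
    by (simp add: g(2) sgn_eq norm_exp_eq_Re \<theta>_def) (simp add: exp_eq_polar exp_of_real)
  have cont': "continuous_on UNIV (\<lambda>t. \<theta> (t + 2 * pi))"
    by (rule continuous_on_compose2[OF cont]) (auto intro!: continuous_intros)
  have "[\<theta> t = \<theta> (t + 2 * pi)] (rmod (2 * pi))" for t
    using velocity_periodic[OF \<alpha>, of t] by (simp flip: cis_eq_iff angle)
  then obtain n where "\<And>t. \<theta> (t + 2 * pi) = \<theta> t + 2 * pi * of_int n"
    using congruent_continuous_imp_differ_by_constant[OF cont cont'] by blast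
  with cont angle show ?thesis
    unfolding has_turning_number_def tangent_angle_def by blast
qed

text \<open>A closed curve cannot advance in one direction for ever.\<close>

lemma tangent_angle_not_constant:
  assumes \<alpha>: "immersed_loop 1 \<alpha>" and \<theta>: "tangent_angle \<alpha> \<theta>"
  shows "\<exists>t. \<theta> t \<noteq> \<theta> s"
proof (rule ccontr)
  assume "\<not> ?thesis"
  then have const: "\<And>t. \<theta> t = \<theta> s" by blast
  define g where "g t = Re (\<alpha> t * cis (- \<theta> s))" for t
  have "g 0 < g (2 * pi)"
  proof (rule DERIV_pos_imp_increasing[of 0 "2 * pi" g])
    fix t :: real
    have "velocity \<alpha> t * cis (- \<theta> s) = of_real (norm (velocity \<alpha> t))"
      by (subst velocity_eq_speed_times_angle[OF \<theta>]) (simp add: const[of t] cis_mult mult.assoc)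
    moreover have "((\<lambda>t. \<alpha> t * cis (- \<theta> s)) has_vector_derivative velocity \<alpha> t * cis (- \<theta> s)) (at t)"
      by (intro derivative_intros has_velocity \<alpha>)
    ultimately have "(g has_real_derivative norm (velocity \<alpha> t)) (at t)"
      unfolding g_def using has_vector_derivative_complex_iff by (metis Re_complex_of_real)
    then show "\<exists>y. (g has_real_derivative y) (at t) \<and> 0 < y"
      using velocity_nonzero[OF \<alpha>] by (intro exI conjI) auto
  qed simp
  moreover have "\<alpha> (2 * pi) = \<alpha> 0"
    using loop_periodic[OF \<alpha>, of 0] by simp
  ultimately show False by (simp add: g_def)
qed

text \<open>
  Integrating from \<open>0\<close> to \<open>t\<close> and rescaling to the unit interval turns the joint continuity of the
  primitives into the continuity of an integral with parameters, for both signs of \<open>t\<close>.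
\<close>

lemma ex_jointly_continuous_primitive:
  fixes f :: "'a::topological_space \<Rightarrow> real \<Rightarrow> complex"
  assumes cont: "continuous_on (S \<times> UNIV) (\<lambda>(s, t). f s t)"
  obtains F where "\<And>s t. s \<in> S \<Longrightarrow> (F s has_vector_derivative f s t) (at t)"
    "\<And>s. F s 0 = 0" "continuous_on (S \<times> UNIV) (\<lambda>(s, t). F s t)"
proof -
  have "\<exists>P. \<forall>t. (P has_vector_derivative f s t) (at t)" if "s \<in> S" for s
  proof -
    have "continuous_on UNIV (\<lambda>t. (\<lambda>(s, t). f s t) (s, t))"
      by (rule continuous_on_compose2[OF cont]) (use that in \<open>auto intro!: continuous_intros\<close>)
    then have "isCont (f s) t" for t
      by (simp add: continuous_on_eq_continuous_at)
    then show ?thesis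
      using einterval_antiderivative[of "-\<infinity>" "\<infinity>" "f s"] by auto
  qed
  then obtain P where P: "\<And>s t. s \<in> S \<Longrightarrow> (P s has_vector_derivative f s t) (at t)"
    by metis
  define F where "F s t = P s t - P s 0" for s t
  have F: "(F s has_vector_derivative f s t) (at t)" if "s \<in> S" for s t
    unfolding F_def using P[OF that] by (auto intro!: derivative_eq_intros)
  define K where "K x v = snd x *\<^sub>R f (fst x) (snd x * v)" for x :: "'a \<times> real" and v :: real
  have eq: "integral {0..1} (K (s, t)) = F s t" if "s \<in> S" for s t
  proof -
    have "((\<lambda>v. P s (t * v)) has_vector_derivative K (s, t) v) (at v within {0..1})" for v
    proof -
      have "((P s \<circ> (\<lambda>v. t * v)) has_vector_derivative t *\<^sub>R f s (t * v)) (at v)"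
        by (rule vector_diff_chain_at) (auto intro!: derivative_eq_intros P that)
      then show ?thesis
        by (simp add: K_def o_def has_vector_derivative_at_within)
    qed
    then have "(K (s, t) has_integral P s (t * 1) - P s (t * 0)) {0..1}"
      by (intro fundamental_theorem_of_calculus) auto
    then show ?thesis
      by (simp add: F_def integral_unique)
  qed
  have "continuous_on ((S \<times> UNIV) \<times> cbox 0 1) (\<lambda>(x, v). K x v)"
  proof -
    have "continuous_on ((S \<times> UNIV) \<times> cbox 0 1)
        (\<lambda>y. snd (fst y) *\<^sub>R (\<lambda>(s, t). f s t) (fst (fst y), snd (fst y) * snd y))"
      by (intro continuous_intros continuous_on_compose2[OF cont]) auto
    then show ?thesis by (simp add: K_def case_prod_beta)
  qed
  then have "continuous_on (S \<times> UNIV) (\<lambda>x. integral (cbox 0 1) (K x))"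
    by (rule integral_continuous_on_param)
  then have "continuous_on (S \<times> UNIV) (\<lambda>(s, t). F s t)"
    by (rule continuous_on_eq) (auto simp: eq)
  with F show ?thesis
    by (intro that[of F]) (auto simp: F_def)
qed

lemma has_vector_derivative_unique_primitive:
  fixes F G :: "real \<Rightarrow> 'a::real_normed_vector"
  assumes "\<And>t. (F has_vector_derivative f t) (at t)" "\<And>t. (G has_vector_derivative f t) (at t)"
  shows "F t - F s = G t - G s"
proof -
  have "((\<lambda>t. F t - G t) has_derivative (\<lambda>h. 0)) (at x within UNIV)" for x
    using has_vector_derivative_diff[OF assms(1)[of x] assms(2)[of x]]
    by (simp add: has_vector_derivative_def)
  then have "\<exists>c. \<forall>x\<in>UNIV. F x - G x = c"
    by (intro has_derivative_zero_constant) auto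
  then obtain c where "\<And>x. F x - G x = c" by auto
  from this[of t] this[of s] show ?thesis
    by (simp add: algebra_simps)
qed

lemma periodic_primitive:
  fixes F :: "real \<Rightarrow> complex"
  assumes F: "\<And>t. (F has_vector_derivative f t) (at t)"
    and per: "\<And>t. f (t + 2 * pi) = f t" and closed: "F (2 * pi) = F 0"
  shows "F (t + 2 * pi) = F t"
proof -
  have "((F \<circ> (\<lambda>t. t + 2 * pi)) has_vector_derivative (1 *\<^sub>R f (t + 2 * pi))) (at t)" for t
    by (rule vector_diff_chain_at) (auto intro!: derivative_eq_intros F)
  then have "((\<lambda>t. F (t + 2 * pi)) has_vector_derivative f t) (at t)" for t
    by (simp add: o_def per)
  from has_vector_derivative_unique_primitive[OF this F, of t 0] show ?thesis
    by (simp add: closed)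
qed

text \<open>
  A weighted mean of unit vectors lies strictly inside the unit disc unless the vectors all
  coincide. In particular, if the mean is one of them, the angle is constant.
\<close>

lemma mean_direction_not_attained:
  fixes \<rho> \<theta> :: "real \<Rightarrow> real"
  assumes \<rho>: "continuous_on UNIV \<rho>" "\<And>t. \<rho> t > 0" and \<theta>: "continuous_on UNIV \<theta>"
    and per: "\<And>t. cis (\<theta> (t + 2 * pi)) = cis (\<theta> t)"
    and mean: "integral {0..2 * pi} (\<lambda>t. of_real (\<rho> t) * (cis (\<theta> t) - cis (\<theta> s))) = 0"
  shows "\<theta> t = \<theta> s"
proof -
  define g where "g t = of_real (\<rho> t) * (cis (\<theta> t) - cis (\<theta> s))" for t
  have contcis: "continuous_on A (\<lambda>t. cis (\<theta> t))" for A
    unfolding cis_conv_exp by (intro continuous_intros continuous_on_subset[OF \<theta>]) auto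
  have cont: "continuous_on {0..2 * pi} g"
    unfolding g_def by (intro continuous_intros contcis continuous_on_subset[OF \<rho>(1)]) auto
  have Re_g: "Re (- cis (- \<theta> s) * g t) = \<rho> t * (1 - cos (\<theta> t - \<theta> s))" for t
  proof -
    have "- cis (- \<theta> s) * g t
        = of_real (\<rho> t) * (cis (- \<theta> s) * cis (\<theta> s) - cis (- \<theta> s) * cis (\<theta> t))"
      by (simp add: g_def algebra_simps)
    also have "\<dots> = of_real (\<rho> t) * (1 - cis (\<theta> t - \<theta> s))"
      by (simp add: cis_mult)
    finally have "- cis (- \<theta> s) * g t = of_real (\<rho> t) * (1 - cis (\<theta> t - \<theta> s))" .
    then show ?thesis by simp
  qed
  have "integral {0..2 * pi} g = 0"
    unfolding g_def by (rule mean)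
  then have "(g has_integral 0) {0..2 * pi}"
    using integrable_integral[OF integrable_continuous_real[OF cont]] by simp
  then have "((\<lambda>t. Re (- cis (- \<theta> s) * g t)) has_integral Re (- cis (- \<theta> s) * 0)) {0..2 * pi}"
    by (intro has_integral_Re has_integral_mult_right)
  then have "integral {0..2 * pi} (\<lambda>t. \<rho> t * (1 - cos (\<theta> t - \<theta> s))) = 0"
    unfolding Re_g by (simp add: integral_unique)
  then have cos: "\<forall>t\<in>{0..2 * pi}. \<rho> t * (1 - cos (\<theta> t - \<theta> s)) = 0"
    by (subst (asm) integral_eq_0_iff)
      (auto intro!: continuous_intros continuous_on_subset[OF \<rho>(1)] continuous_on_subset[OF \<theta>]
        mult_nonneg_nonneg less_imp_le[OF \<rho>(2)])
  have *: "cis (\<theta> t) = cis (\<theta> s)" if "t \<in> {0..2 * pi}" for t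
  proof -
    have "cos (\<theta> t - \<theta> s) = 1" using cos that \<rho>(2)[of t] by (auto dest!: bspec[of _ _ t])
    then obtain k :: int where "\<theta> t - \<theta> s = of_int k * 2 * pi"
      using cos_one_2pi_int by blast
    then have "[\<theta> s = \<theta> t] (rmod (2 * pi))"
      by (auto simp: rcong_altdef algebra_simps intro!: exI[of _ k])
    then show ?thesis by (metis cis_eq_iff)
  qed
  have "cis (\<theta> t) = cis (\<theta> s)" for t
  proof -
    obtain r where r: "r \<in> {0..<2 * pi}" "[r = t] (rmod (2 * pi))"
      by (rule representative_in_period)
    show ?thesis
      using periodic_cong[of "\<lambda>t. cis (\<theta> t)", OF per r(2)] *[of r] r(1) by simp
  qed
  then have "\<And>t. [\<theta> s = \<theta> t] (rmod (2 * pi))"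
    by (metis cis_eq_iff)
  then obtain n :: int where "\<And>t. \<theta> t = \<theta> s + 2 * pi * of_int n"
    using congruent_continuous_imp_differ_by_constant[OF continuous_on_const \<theta>] by metis
  from this[of t] this[of s] show ?thesis by simp
qed

lemma periodic_attains_max:
  fixes A :: "real \<Rightarrow> real"
  assumes "continuous_on UNIV A" and per: "\<And>t. A (t + 2 * pi) = A t"
  obtains a where "\<And>t. A t \<le> A a"
proof -
  have "\<exists>a\<in>{0..2 * pi}. \<forall>t\<in>{0..2 * pi}. A t \<le> A a"
    by (rule continuous_attains_sup) (auto intro: continuous_on_subset[OF assms(1)])
  then obtain a where a: "\<And>t. t \<in> {0..2 * pi} \<Longrightarrow> A t \<le> A a" by blast
  have "A t \<le> A a" for t
  proof -
    obtain r where r: "r \<in> {0..<2 * pi}" "[r = t] (rmod (2 * pi))"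
      by (rule representative_in_period)
    with a[of r] periodic_cong[of A, OF per r(2)] show ?thesis by simp
  qed
  then show ?thesis by (rule that)
qed

text \<open>
  The linear interpolation of two angle functions could be constant at an intermediate time when
  the turning number is zero. Shifting the parameters so that both angles reach their maximum
  simultaneously excludes this: a term of positive weight then falls short of its maximum somewhere, and
  the two deficits cannot cancel.
\<close>

lemma ex_nonconstant_interpolation:
  fixes A B :: "real \<Rightarrow> real"
  assumes A: "continuous_on UNIV A" "\<And>t. A (t + 2 * pi) = A t + 2 * pi * of_int n"
      "\<And>s. \<exists>t. A t \<noteq> A s"
    and B: "continuous_on UNIV B" "\<And>t. B (t + 2 * pi) = B t + 2 * pi * of_int n"
      "\<And>s. \<exists>t. B t \<noteq> B s"
  obtains \<delta> where "\<And>s x. s \<in> {0..1} \<Longrightarrow>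
    \<exists>t. (1 - s) * A (t + s * \<delta>) + s * B (t - (1 - s) * \<delta>)
      \<noteq> (1 - s) * A (x + s * \<delta>) + s * B (x - (1 - s) * \<delta>)"
proof (cases "n = 0")
  case False
  have "(1 - s) * A (x + 2 * pi) + s * B (x + 2 * pi) \<noteq> (1 - s) * A x + s * B x" for s x
  proof -
    have "(1 - s) * A (x + 2 * pi) + s * B (x + 2 * pi) = (1 - s) * A x + s * B x + 2 * pi * of_int n"
      unfolding A(2) B(2) by (simp add: algebra_simps)
    with False show ?thesis by simp
  qed
  then show ?thesis by (intro that[of 0]) auto
next
  case True
  obtain a where a: "\<And>t. A t \<le> A a"
    using periodic_attains_max[of A] A(1,2) True by auto
  obtain b where b: "\<And>t. B t \<le> B b"
    using periodic_attains_max[of B] B(1,2) True by auto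
  define \<delta> where "\<delta> = a - b"
  define \<Theta> where "\<Theta> s t = (1 - s) * A (t + s * \<delta>) + s * B (t - (1 - s) * \<delta>)" for s t
  have "\<exists>t. \<Theta> s t \<noteq> \<Theta> s x" if s: "s \<in> {0..1}" for s x
  proof (rule ccontr)
    assume "\<not> ?thesis"
    then have "\<Theta> s t = \<Theta> s (a - s * \<delta>)" for t by metis
    moreover have "\<Theta> s (a - s * \<delta>) = (1 - s) * A a + s * B b"
    proof -
      have "a - s * \<delta> - (1 - s) * \<delta> = b" by (simp add: \<delta>_def algebra_simps)
      then show ?thesis by (simp add: \<Theta>_def)
    qed
    ultimately have "\<Theta> s t = (1 - s) * A a + s * B b" for t by metis
    then have sum: "(1 - s) * (A a - A (t + s * \<delta>)) + s * (B b - B (t - (1 - s) * \<delta>)) = 0" for t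
      unfolding \<Theta>_def right_diff_distrib[of "1 - s"] right_diff_distrib[of s] by (metis add_diff_add right_minus_eq)
    have nn: "(1 - s) * (A a - A u) \<ge> 0" "s * (B b - B u) \<ge> 0" for u
      using s a b by (auto intro!: mult_nonneg_nonneg)
    have zero: "(1 - s) * (A a - A (t + s * \<delta>)) = 0" "s * (B b - B (t - (1 - s) * \<delta>)) = 0" for t
      using sum[of t] nn(1)[of "t + s * \<delta>"] nn(2)[of "t - (1 - s) * \<delta>"] by linarith+
    show False
    proof (cases "s = 1")
      case True
      then have "B b = B u" for u using zero(2)[of u] by simp
      then show False using B(3) by metis
    next
      case False
      then have "A a = A u" for u using zero(1)[of "u - s * \<delta>"] by simp
      then show False using A(3) by metis
    qed
  qed
  then show ?thesis by (intro that[of \<delta>]) (simp add: \<Theta>_def)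
qed

text \<open>
  The Whitney--Graustein theorem: interpolate the tangent angles and the speeds, and restore closedness by
  subtracting from the unit tangent its mean, weighted with the speed. Weighting with the speed
  makes the correction vanish at both ends, because \<open>\<alpha>\<close> and \<open>\<beta>\<close> are closed already.
\<close>

proposition same_turning_number_imp_regularly_homotopic:
  assumes \<alpha>: "immersed_loop 1 \<alpha>" "has_turning_number \<alpha> n"
    and \<beta>: "immersed_loop 1 \<beta>" "has_turning_number \<beta> n"
  shows "regularly_homotopic \<alpha> \<beta>"
proof -
  obtain A where A: "tangent_angle \<alpha> A" "\<And>t. A (t + 2 * pi) = A t + 2 * pi * of_int n"
    using \<alpha>(2) by (auto simp: has_turning_number_def)
  obtain B where B: "tangent_angle \<beta> B" "\<And>t. B (t + 2 * pi) = B t + 2 * pi * of_int n"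
    using \<beta>(2) by (auto simp: has_turning_number_def)
  have contA: "continuous_on UNIV A" and contB: "continuous_on UNIV B"
    using A B by (auto simp: tangent_angle_def)
  obtain \<delta> where \<delta>: "\<And>s x. s \<in> {0..1} \<Longrightarrow>
    \<exists>t. (1 - s) * A (t + s * \<delta>) + s * B (t - (1 - s) * \<delta>)
      \<noteq> (1 - s) * A (x + s * \<delta>) + s * B (x - (1 - s) * \<delta>)"
    using ex_nonconstant_interpolation[OF contA A(2) tangent_angle_not_constant[OF \<alpha>(1) A(1)]
        contB B(2) tangent_angle_not_constant[OF \<beta>(1) B(1)]] by blast
  define \<theta> where "\<theta> s t = (1 - s) * A (t + s * \<delta>) + s * B (t - (1 - s) * \<delta>)" for s t
  define \<rho> where "\<rho> s t = (1 - s) * norm (velocity \<alpha> t) + s * norm (velocity \<beta> t)" for s t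
  define w where "w s t = complex_of_real (\<rho> s t) * cis (\<theta> s t)" for s t
  define m where "m s = integral {0..2 * pi} (w s) / of_real (integral {0..2 * pi} (\<rho> s))" for s
  define f where "f s t = w s t - of_real (\<rho> s t) * m s" for s t
  define I where "I = {0..1 :: real}"

  have \<rho>_pos: "\<rho> s t > 0" if "s \<in> I" for s t
  proof (cases "s = 1")
    case False
    then have "(1 - s) * norm (velocity \<alpha> t) > 0" "s * norm (velocity \<beta> t) \<ge> 0"
      using that velocity_nonzero[OF \<alpha>(1)] by (auto simp: I_def)
    then show ?thesis by (simp add: \<rho>_def)
  qed (use velocity_nonzero[OF \<beta>(1)] in \<open>simp add: \<rho>_def\<close>)
  have cont_\<theta>: "continuous_on T (\<lambda>x. \<theta> (g x) (h x))"
    and cont_\<rho>: "continuous_on T (\<lambda>x. \<rho> (g x) (h x))"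
    and cont_w: "continuous_on T (\<lambda>x. w (g x) (h x))"
    if gh: "continuous_on T g" "continuous_on T h" for T :: "'z::topological_space set" and g h
  proof -
    show 1: "continuous_on T (\<lambda>x. \<theta> (g x) (h x))"
      unfolding \<theta>_def
      by (intro continuous_intros gh continuous_on_compose2[OF contA] continuous_on_compose2[OF contB]) auto
    show 2: "continuous_on T (\<lambda>x. \<rho> (g x) (h x))"
      unfolding \<rho>_def
      by (intro continuous_intros gh continuous_on_compose2[OF continuous_velocity[OF \<alpha>(1)]]
          continuous_on_compose2[OF continuous_velocity[OF \<beta>(1)]]) auto
    show "continuous_on T (\<lambda>x. w (g x) (h x))"
      unfolding w_def cis_conv_exp by (intro continuous_intros 1 2)
  qed
  have \<rho>_int_pos: "integral {0..2 * pi} (\<rho> s) > 0" if "s \<in> I" for s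
  proof -
    have c: "continuous_on {0..2 * pi} (\<rho> s)"
      by (intro cont_\<rho> continuous_intros)
    have "integral {0..2 * pi} (\<rho> s) \<ge> 0"
      using integrable_continuous_real[OF c] less_imp_le[OF \<rho>_pos[OF that]]
      by (intro integral_nonneg) auto
    moreover have "integral {0..2 * pi} (\<rho> s) \<noteq> 0"
      using \<rho>_pos[OF that] less_imp_le[OF \<rho>_pos[OF that]]
      by (subst integral_eq_0_iff[OF c]) (auto intro!: bexI[of _ 0] simp: less_le)
    ultimately show ?thesis by simp
  qed
  have cont_m: "continuous_on I m"
  proof -
    have "continuous_on (I \<times> cbox 0 (2 * pi)) (\<lambda>(s, t). w s t)"
      "continuous_on (I \<times> cbox 0 (2 * pi)) (\<lambda>(s, t). \<rho> s t)"
      unfolding case_prod_beta by (intro cont_w cont_\<rho> continuous_intros)+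
    from this[THEN integral_continuous_on_param] \<rho>_int_pos show ?thesis
      unfolding m_def by (intro continuous_intros) (auto simp: less_le)
  qed
  have cont_f: "continuous_on (I \<times> UNIV) (\<lambda>(s, t). f s t)"
    unfolding case_prod_beta f_def
    by (intro continuous_intros cont_w cont_\<rho> continuous_on_compose2[OF cont_m]) auto
  obtain F where F: "\<And>s t. s \<in> I \<Longrightarrow> (F s has_vector_derivative f s t) (at t)"
    "\<And>s. F s 0 = 0" "continuous_on (I \<times> UNIV) (\<lambda>(s, t). F s t)"
    using ex_jointly_continuous_primitive[OF cont_f] by blast
  have \<theta>_shift: "\<theta> s (t + 2 * pi) = \<theta> s t + 2 * pi * of_int n" for s t
    using A(2)[of "t + s * \<delta>"] B(2)[of "t - (1 - s) * \<delta>"]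
    by (simp add: \<theta>_def algebra_simps)
  have cis_\<theta>_shift: "cis (\<theta> s (t + 2 * pi)) = cis (\<theta> s t)" for s t
    unfolding cis_eq_iff \<theta>_shift by (subst rcong_sym_iff) (auto simp: rcong_altdef)
  have f_periodic: "f s (t + 2 * pi) = f s t" for s t
    by (simp add: f_def w_def \<rho>_def cis_\<theta>_shift velocity_periodic[OF \<alpha>(1)] velocity_periodic[OF \<beta>(1)])
  have f_integral: "(f s has_integral F s (2 * pi)) {0..2 * pi}" if "s \<in> I" for s
    using fundamental_theorem_of_calculus[of 0 "2 * pi" "F s" "f s"] F(1,2) that
    by (simp add: has_vector_derivative_at_within)
  have F_closed: "F s (2 * pi) = 0" if "s \<in> I" for s
  proof -
    have "w s integrable_on {0..2 * pi}" "\<rho> s integrable_on {0..2 * pi}"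
      by (intro integrable_continuous_real cont_w cont_\<rho> continuous_intros)+
    then have "(f s has_integral (integral {0..2 * pi} (w s) - of_real (integral {0..2 * pi} (\<rho> s)) * m s)) {0..2 * pi}"
      unfolding f_def
      by (intro has_integral_diff has_integral_mult_left has_integral_of_real integrable_integral)
    moreover have "integral {0..2 * pi} (w s) - of_real (integral {0..2 * pi} (\<rho> s)) * m s = 0"
      using \<rho>_int_pos[OF that] by (simp add: m_def)
    ultimately show ?thesis
      using f_integral[OF that] has_integral_unique by metis
  qed
  have f_nonzero: "f s t \<noteq> 0" if s: "s \<in> I" for s t
  proof
    assume "f s t = 0"
    then have m: "m s = cis (\<theta> s t)"
      using \<rho>_pos[OF s, of t] by (simp add: f_def w_def)
    have "integral {0..2 * pi} (\<lambda>x. of_real (\<rho> s x) * (cis (\<theta> s x) - cis (\<theta> s t))) = 0"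
      using f_integral[OF s] F_closed[OF s] unfolding f_def w_def m
      by (simp add: right_diff_distrib integral_unique)
    then have "\<theta> s x = \<theta> s t" for x
      by (intro mean_direction_not_attained[of "\<rho> s" "\<theta> s"] cont_\<rho> cont_\<theta> continuous_intros \<rho>_pos s cis_\<theta>_shift)
    then show False
      using \<delta>[of s t] s by (auto simp: \<theta>_def I_def)
  qed

  define H where "H s t = of_real (1 - s) * \<alpha> 0 + of_real s * \<beta> 0 + F s t" for s t
  have H: "(H s has_vector_derivative f s t) (at t)" if "s \<in> I" for s t
    unfolding H_def using F(1)[OF that] by (auto intro!: derivative_eq_intros)
  have vel: "velocity (H s) t = f s t" if "s \<in> I" for s t
    using H[OF that] by (rule vector_derivative_at)
  \<comment> \<open>At an end the mean is the integral of the velocity of a closed curve.\<close>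
  have end_point: "f s t = velocity \<gamma> t" if "immersed_loop 1 \<gamma>" "s \<in> I" "\<And>t. w s t = velocity \<gamma> t" for s t \<gamma>
  proof -
    have "(velocity \<gamma> has_integral \<gamma> (2 * pi) - \<gamma> 0) {0..2 * pi}"
      using has_velocity[OF that(1)]
      by (intro fundamental_theorem_of_calculus) (auto intro: has_vector_derivative_at_within)
    then have "(w s has_integral 0) {0..2 * pi}"
      using loop_periodic[OF that(1), of 0] by (simp add: that(3)[abs_def])
    then have "m s = 0"
      by (simp add: m_def integral_unique)
    then show ?thesis by (simp add: f_def that(3))
  qed
  have H0: "H 0 = \<alpha>"
  proof
    fix t
    have "w 0 t = velocity \<alpha> t" for t
      using velocity_eq_speed_times_angle[OF A(1), of t] by (simp add: w_def \<rho>_def \<theta>_def)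
    then have "f 0 t = velocity \<alpha> t" for t
      by (intro end_point \<alpha>) (auto simp: I_def)
    then have "H 0 t - H 0 0 = \<alpha> t - \<alpha> 0"
      using H[of 0] has_velocity[OF \<alpha>(1)]
      by (intro has_vector_derivative_unique_primitive) (auto simp: I_def)
    then show "H 0 t = \<alpha> t" by (simp add: H_def F(2))
  qed
  have H1: "H 1 = \<beta>"
  proof
    fix t
    have "w 1 t = velocity \<beta> t" for t
      using velocity_eq_speed_times_angle[OF B(1), of t] by (simp add: w_def \<rho>_def \<theta>_def)
    then have "f 1 t = velocity \<beta> t" for t
      by (intro end_point \<beta>) (auto simp: I_def)
    then have "H 1 t - H 1 0 = \<beta> t - \<beta> 0"
      using H[of 1] has_velocity[OF \<beta>(1)]
      by (intro has_vector_derivative_unique_primitive) (auto simp: I_def)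
    then show "H 1 t = \<beta> t" by (simp add: H_def F(2))
  qed
  have "immersed_loop 1 (H s)" if s: "s \<in> I" for s
    unfolding immersed_loop_def C_k_1_iff
  proof (intro conjI allI exI[of _ "f s"])
    show "H s (t + 2 * pi) = H s t" for t
      by (rule periodic_primitive[OF H[OF s] f_periodic]) (simp add: H_def F_closed s F(2))
    show "continuous_on UNIV (f s)"
      unfolding f_def by (intro continuous_intros cont_w cont_\<rho>)
  qed (use H s vel f_nonzero in auto)
  moreover have "continuous_on (I \<times> UNIV) (\<lambda>(s, t). H s t)"
    using F(3) unfolding case_prod_beta H_def by (intro continuous_intros)
  moreover have "continuous_on (I \<times> UNIV) (\<lambda>(s, t). velocity (H s) t)"
    using cont_f by (rule continuous_on_eq) (auto simp: vel)
  ultimately show ?thesis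
    unfolding regularly_homotopic_def using H0 H1 by (auto simp: I_def intro!: exI[of _ H])
qed

section \<open>The symmetry as a map of the circle\<close>

lemma immersed_loop_reflect:
  assumes "immersed_loop 2 \<alpha>"
  shows "immersed_loop 2 (\<lambda>t. 2 * c - \<alpha> t)" "velocity (\<lambda>t. 2 * c - \<alpha> t) t = - velocity \<alpha> t"
proof -
  note \<alpha> = immersed_loop_2_imp_1[OF assms]
  have D: "((\<lambda>t. 2 * c - \<alpha> t) has_vector_derivative - velocity \<alpha> t) (at t)" for t
    by (auto intro!: derivative_eq_intros has_velocity \<alpha>)
  then show vel: "velocity (\<lambda>t. 2 * c - \<alpha> t) t = - velocity \<alpha> t" for t
    by (rule vector_derivative_at)
  obtain a where a: "\<And>t. (velocity \<alpha> has_vector_derivative a t) (at t)" "continuous_on UNIV a"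
    using C_k_velocity[OF assms] unfolding C_k_1_iff by blast
  have "C_k 1 (\<lambda>t. - velocity \<alpha> t)"
    unfolding C_k_1_iff using a
    by (intro exI[of _ "\<lambda>t. - a t"]) (auto intro!: derivative_intros continuous_intros)
  then have "C_k 2 (\<lambda>t. 2 * c - \<alpha> t)"
    using D by (intro C_k_2I)
  then show "immersed_loop 2 (\<lambda>t. 2 * c - \<alpha> t)"
    using loop_periodic[OF assms] velocity_nonzero[OF assms]
    by (simp add: immersed_loop_def vel)
qed

lemma reflecting_map_velocity:
  assumes \<alpha>: "immersed_loop 1 \<alpha>" and refl: "\<And>t. \<alpha> (\<phi> t) = 2 * c - \<alpha> t"
    and \<phi>: "(\<phi> has_real_derivative D) (at t)"
  shows "of_real D * velocity \<alpha> (\<phi> t) = - velocity \<alpha> t" "D \<noteq> 0"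
    "- velocity \<alpha> t / velocity \<alpha> (\<phi> t) = of_real D"
proof -
  have "((\<alpha> \<circ> \<phi>) has_vector_derivative D *\<^sub>R velocity \<alpha> (\<phi> t)) (at t)"
    by (rule vector_diff_chain_at[OF _ has_velocity[OF \<alpha>]])
       (use \<phi> in \<open>simp add: has_real_derivative_iff_has_vector_derivative\<close>)
  moreover have "\<alpha> \<circ> \<phi> = (\<lambda>t. 2 * c - \<alpha> t)" by (auto simp: refl)
  moreover have "((\<lambda>t. 2 * c - \<alpha> t) has_vector_derivative - velocity \<alpha> t) (at t)"
    by (auto intro!: derivative_eq_intros has_velocity \<alpha>)
  ultimately have "D *\<^sub>R velocity \<alpha> (\<phi> t) = - velocity \<alpha> t"
    using vector_derivative_unique_at by metis
  then show *: "of_real D * velocity \<alpha> (\<phi> t) = - velocity \<alpha> t"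
    by (simp add: scaleR_conv_of_real)
  then show "D \<noteq> 0" using velocity_nonzero[OF \<alpha>] by auto
  show "- velocity \<alpha> t / velocity \<alpha> (\<phi> t) = of_real D"
    using velocity_nonzero[OF \<alpha>] by (simp flip: *)
qed

text \<open>
  The tangent parameter \<open>\<phi> t\<close> of the reflected loop has derivative \<open>\<beta>' t / \<alpha>' (\<phi> t)\<close>, which is
  again differentiable because \<open>\<phi>\<close> is. Reflecting twice gives back \<open>\<alpha> t\<close> with a parallel velocity,
  so \<open>\<phi>\<close> is its own inverse on the circle.
\<close>

lemma ex_reflecting_diffeo:
  assumes \<alpha>: "immersed_loop 2 \<alpha>" and cl: "clean \<alpha>" and cen: "central \<alpha> c"
  obtains \<phi> \<phi>' where "circle_diffeo 2 \<phi>" "\<And>t. \<alpha> (\<phi> t) = 2 * c - \<alpha> t"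
    "\<And>t. (\<phi> has_real_derivative \<phi>' t) (at t)" "C_k 1 \<phi>'" "\<And>t. [\<phi> (\<phi> t) = t] (rmod (2 * pi))"
proof -
  define \<beta> where "\<beta> t = 2 * c - \<alpha> t" for t
  note \<alpha>1 = immersed_loop_2_imp_1[OF \<alpha>]
  have \<beta>: "immersed_loop 2 \<beta>" and vel: "velocity \<beta> t = - velocity \<alpha> t" for t
    unfolding \<beta>_def using immersed_loop_reflect[OF \<alpha>] by auto
  note \<beta>1 = immersed_loop_2_imp_1[OF \<beta>]
  have "range \<beta> \<subseteq> range \<alpha>"
    using cen unfolding central_def \<beta>_def by blast
  then obtain \<phi> where cont: "continuous_on UNIV \<phi>" and eq: "\<And>t. \<alpha> (\<phi> t) = \<beta> t"
    and par: "\<And>t. velocity \<beta> t / velocity \<alpha> (\<phi> t) \<in> \<real>"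
    using ex_continuous_tangent_parameter[OF \<alpha>1 cl \<beta>1] by blast
  define \<phi>' where "\<phi>' t = Re (velocity \<beta> t / velocity \<alpha> (\<phi> t))" for t
  have D: "(\<phi> has_real_derivative \<phi>' t) (at t)" for t
  proof -
    have "(\<phi> \<longlongrightarrow> \<phi> t) (at t)"
      using cont by (simp add: continuous_on_def)
    then have "((\<lambda>y. (\<phi> y - \<phi> t) / (y - t)) \<longlongrightarrow> \<phi>' t) (at t)"
      unfolding \<phi>'_def
      by (intro increment_ratio_real_limit(2)[OF has_velocity[OF \<alpha>1] velocity_nonzero[OF \<alpha>1]
            has_velocity[OF \<beta>1] eq])
         (auto simp: eq eventually_at_filter)
    then show ?thesis by (simp add: has_field_derivative_iff)
  qed
  have "continuous_on UNIV \<phi>'"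
    unfolding \<phi>'_def
    by (intro continuous_intros continuous_velocity[OF \<beta>1] continuous_on_compose2[OF continuous_velocity[OF \<alpha>1]] cont)
       (auto simp: velocity_nonzero[OF \<alpha>1])
  then have "C_k 1 \<phi>"
    using D unfolding C_k_1_real_iff by blast
  then have C1: "C_k 1 \<phi>'"
    unfolding \<phi>'_def
    by (intro C_k_1_Re_divide[OF C_k_velocity[OF \<beta>] C_k_1_compose[OF C_k_velocity[OF \<alpha>]]]
        velocity_nonzero[OF \<alpha>])
  have C2: "C_k 2 \<phi>"
    using D C1 by (intro C_k_2I[of \<phi> \<phi>']) (simp_all add: has_real_derivative_iff_has_vector_derivative)
  have refl: "\<alpha> (\<phi> t) = 2 * c - \<alpha> t" for t
    by (simp add: eq \<beta>_def)
  have cont_shift: "continuous_on UNIV (\<lambda>t. \<phi> (t + 2 * pi))"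
    by (rule continuous_on_compose2[OF cont]) (auto intro!: continuous_intros)
  have "[\<phi> t = \<phi> (t + 2 * pi)] (rmod (2 * pi))" for t
  proof (rule clean_tangent_parameter_unique[OF cl \<alpha>])
    show "\<alpha> (\<phi> t) = \<alpha> (\<phi> (t + 2 * pi))"
      by (simp add: refl loop_periodic[OF \<alpha>])
    show "velocity \<beta> t / velocity \<alpha> (\<phi> (t + 2 * pi)) \<in> \<real>"
      using par[of "t + 2 * pi"] by (simp only: velocity_periodic[OF \<beta>1])
  qed (use par velocity_nonzero[OF \<beta>] in auto)
  then obtain d where "\<And>t. \<phi> (t + 2 * pi) = \<phi> t + 2 * pi * of_int d"
    using congruent_continuous_imp_differ_by_constant[OF cont cont_shift] by blast
  with C2 have map: "circle_map 2 \<phi>"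
    unfolding circle_map_def by blast
  have inv: "[\<phi> (\<phi> t) = t] (rmod (2 * pi))" for t
  proof (rule clean_tangent_parameter_unique[OF cl \<alpha>])
    show "\<alpha> (\<phi> (\<phi> t)) = \<alpha> t" by (simp add: refl)
    show "velocity \<alpha> (\<phi> t) / velocity \<alpha> (\<phi> (\<phi> t)) \<in> \<real>"
      using par[of "\<phi> t"] by (simp add: vel)
    have "inverse (velocity \<beta> t / velocity \<alpha> (\<phi> t)) \<in> \<real>"
      using par[of t] by (rule Reals_inverse)
    then show "velocity \<alpha> (\<phi> t) / velocity \<alpha> t \<in> \<real>"
      by (simp add: vel)
  qed (rule velocity_nonzero[OF \<alpha>])
  have "circle_diffeo 2 \<phi>"
    unfolding circle_diffeo_def using map inv by blast
  then show ?thesis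
    using that refl D C1 inv by blast
qed

text \<open>
  Any two reflecting maps pick the branch with the same tangent, so they differ by full turns.
  This excludes that the symmetry both preserves and reverses the orientation.
\<close>

lemma reflecting_maps_same_derivative:
  assumes \<alpha>: "immersed_loop 1 \<alpha>" and cl: "clean \<alpha>"
    and refl: "\<And>t. \<alpha> (\<phi> t) = 2 * c - \<alpha> t" "\<And>t. \<alpha> (\<psi> t) = 2 * c - \<alpha> t"
    and D: "\<And>t. (\<phi> has_real_derivative \<phi>' t) (at t)" "\<And>t. (\<psi> has_real_derivative \<psi>' t) (at t)"
  shows "\<phi>' t = \<psi>' t"
proof -
  have cont: "continuous_on UNIV \<phi>" "continuous_on UNIV \<psi>"
    using D by (meson DERIV_isCont continuous_at_imp_continuous_on)+
  have "[\<phi> t = \<psi> t] (rmod (2 * pi))" for t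
  proof (rule clean_tangent_parameter_unique[OF cl \<alpha>])
    show "\<alpha> (\<phi> t) = \<alpha> (\<psi> t)" by (simp add: refl)
    show "- velocity \<alpha> t / velocity \<alpha> (\<phi> t) \<in> \<real>" "- velocity \<alpha> t / velocity \<alpha> (\<psi> t) \<in> \<real>"
      using reflecting_map_velocity(3)[OF \<alpha>] refl D by (metis Reals_of_real)+
  qed (use velocity_nonzero[OF \<alpha>] in auto)
  then obtain n where n: "\<And>t. \<psi> t = \<phi> t + 2 * pi * of_int n"
    using congruent_continuous_imp_differ_by_constant[OF cont] by blast
  have "((\<lambda>t. \<phi> t + 2 * pi * of_int n) has_real_derivative \<phi>' t) (at t)"
    by (auto intro!: derivative_eq_intros D)
  then have "(\<psi> has_real_derivative \<phi>' t) (at t)"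
    by (simp add: n[abs_def])
  then show ?thesis using D(2) DERIV_unique by blast
qed

text \<open>
  Differentiate \<open>\<psi> \<circ> \<phi>\<close>, which is a translation.
\<close>

lemma circle_diffeo_derivative_nonzero:
  assumes "circle_diffeo k \<phi>" "k \<noteq> 0"
  obtains \<phi>' where "\<And>t. (\<phi> has_vector_derivative \<phi>' t) (at t)" "\<And>t. \<phi>' t \<noteq> 0"
proof -
  obtain \<psi> where \<phi>: "circle_map k \<phi>" and \<psi>: "circle_map k \<psi>"
    and inv: "\<And>t. [\<psi> (\<phi> t) = t] (rmod (2 * pi))"
    using assms unfolding circle_diffeo_def by blast
  obtain j where k: "k = Suc j" using assms(2) not0_implies_Suc by blast
  obtain \<phi>' where \<phi>': "\<And>t. (\<phi> has_vector_derivative \<phi>' t) (at t)"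
    using \<phi> by (auto simp: circle_map_def k)
  obtain \<psi>' where \<psi>': "\<And>t. (\<psi> has_vector_derivative \<psi>' t) (at t)"
    using \<psi> by (auto simp: circle_map_def k)
  have chain: "((\<psi> \<circ> \<phi>) has_vector_derivative \<phi>' t *\<^sub>R \<psi>' (\<phi> t)) (at t)" for t
    by (rule vector_diff_chain_at[OF \<phi>' \<psi>'])
  then have cont: "continuous_on UNIV (\<psi> \<circ> \<phi>)"
    by (rule continuous_on_if_has_vector_derivative)
  have "[t = (\<psi> \<circ> \<phi>) t] (rmod (2 * pi))" for t
    using inv by (simp add: rcong_sym)
  then obtain n :: int where n: "\<And>t. (\<psi> \<circ> \<phi>) t = t + 2 * pi * of_int n"
    using congruent_continuous_imp_differ_by_constant[OF continuous_on_id cont] by (metis id_apply)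
  then have "\<psi> \<circ> \<phi> = (\<lambda>t. t + 2 * pi * of_int n)" by blast
  moreover have "((\<lambda>t. t + 2 * pi * of_int n) has_vector_derivative 1) (at t)" for t
    by (auto intro!: derivative_eq_intros)
  ultimately have "\<phi>' t *\<^sub>R \<psi>' (\<phi> t) = 1" for t
    using chain[of t] vector_derivative_unique_at by metis
  then have "\<phi>' t \<noteq> 0" for t
    by (metis scaleR_zero_left zero_neq_one)
  with \<phi>' show ?thesis by (rule that)
qed

text \<open>
  A passage through the center at \<open>t\<close> would be repeated half a turn later with the opposite
  velocity, hence tangentially.
\<close>

lemma diameter_central_avoids_center:
  assumes \<alpha>: "immersed_loop 2 \<alpha>" and cl: "clean \<alpha>" and "diameter_central 2 \<alpha> c"
  shows "c \<notin> range \<alpha>"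
proof
  note \<alpha>1 = immersed_loop_2_imp_1[OF \<alpha>]
  assume "c \<in> range \<alpha>"
  then obtain u where u: "\<alpha> u = c" by auto
  obtain \<eta> where diffeo: "circle_diffeo 2 \<eta>" and refl: "\<And>t. 2 * c - \<alpha> (\<eta> t) = \<alpha> (\<eta> (t + pi))"
    using assms(3) unfolding diameter_central_def reparametrizes_def by auto
  obtain \<psi> d where inv: "\<And>t. [\<psi> (\<eta> t) = t] (rmod (2 * pi))" "\<And>t. [\<eta> (\<psi> t) = t] (rmod (2 * pi))"
    and d: "\<And>t. \<psi> (t + 2 * pi) = \<psi> t + 2 * pi * of_int d"
    using diffeo unfolding circle_diffeo_def circle_map_def by blast
  obtain \<eta>' where \<eta>': "\<And>t. (\<eta> has_vector_derivative \<eta>' t) (at t)" "\<And>t. \<eta>' t \<noteq> 0"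
    using circle_diffeo_derivative_nonzero[OF diffeo] by auto
  define t where "t = \<psi> u"
  have center: "\<alpha> (\<eta> t) = c"
    using periodic_cong[of \<alpha>, OF loop_periodic[OF \<alpha>] inv(2)[of u]] u by (simp add: t_def)
  have "((\<alpha> \<circ> \<eta>) has_vector_derivative \<eta>' (t + pi) *\<^sub>R velocity \<alpha> (\<eta> (t + pi))) (at (t + pi))"
    by (rule vector_diff_chain_at[OF \<eta>'(1) has_velocity[OF \<alpha>1]])
  then have "((\<alpha> \<circ> \<eta>) \<circ> (\<lambda>t. t + pi) has_vector_derivative
      1 *\<^sub>R (\<eta>' (t + pi) *\<^sub>R velocity \<alpha> (\<eta> (t + pi)))) (at t)"
    by (rule vector_diff_chain_at[rotated]) (auto intro!: derivative_eq_intros)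
  then have 1: "((\<lambda>t. \<alpha> (\<eta> (t + pi))) has_vector_derivative \<eta>' (t + pi) *\<^sub>R velocity \<alpha> (\<eta> (t + pi))) (at t)"
    by (simp add: o_def)
  have "((\<alpha> \<circ> \<eta>) has_vector_derivative \<eta>' t *\<^sub>R velocity \<alpha> (\<eta> t)) (at t)"
    by (rule vector_diff_chain_at[OF \<eta>'(1) has_velocity[OF \<alpha>1]])
  then have "((\<lambda>t. 2 * c - \<alpha> (\<eta> t)) has_vector_derivative - (\<eta>' t *\<^sub>R velocity \<alpha> (\<eta> t))) (at t)"
    by (auto simp: o_def intro!: derivative_eq_intros)
  with 1 have eq: "\<eta>' (t + pi) *\<^sub>R velocity \<alpha> (\<eta> (t + pi)) = - (\<eta>' t *\<^sub>R velocity \<alpha> (\<eta> t))"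
    unfolding refl by (rule vector_derivative_unique_at)
  have "[\<eta> (t + pi) = \<eta> t] (rmod (2 * pi))"
  proof (rule clean_parallel_imp_same_parameter[OF cl])
    show "\<alpha> (\<eta> (t + pi)) = \<alpha> (\<eta> t)"
      using refl[of t] center by simp
    have "velocity \<alpha> (\<eta> (t + pi)) / velocity \<alpha> (\<eta> t) = of_real (- \<eta>' t / \<eta>' (t + pi))"
      using eq \<eta>'(2) velocity_nonzero[OF \<alpha>] by (simp add: scaleR_conv_of_real field_simps)
    then show "velocity \<alpha> (\<eta> (t + pi)) / velocity \<alpha> (\<eta> t) \<in> \<real>"
      by (metis Reals_of_real)
  qed (rule velocity_nonzero[OF \<alpha>])
  then obtain n :: int where "\<eta> t = \<eta> (t + pi) + 2 * pi * of_int n"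
    by (auto simp: rcong_altdef mult.commute)
  then have "\<psi> (\<eta> t) = \<psi> (\<eta> (t + pi)) + of_int (d * n) * (2 * pi)"
    using circle_map_shift[of \<psi> d, OF d] by simp
  then have "[\<psi> (\<eta> (t + pi)) = \<psi> (\<eta> t)] (rmod (2 * pi))"
    unfolding rcong_altdef by blast
  then have "[t + pi = t] (rmod (2 * pi))"
    using inv(1) rcong_sym rcong_trans by blast
  then obtain k :: int where "t = t + pi + of_int k * (2 * pi)"
    unfolding rcong_altdef by blast
  then have "pi * (1 + 2 * of_int k) = 0" by (simp add: algebra_simps)
  then have "1 + 2 * real_of_int k = 0" by simp
  then have "1 + 2 * k = 0" by linarith
  then show False by presburger
qed

section \<open>Orientation-preserving symmetry\<close>

text \<open>
  The lower bound on the slope gives surjectivity and a Lipschitz inverse; the regularity of the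
  inverse then follows from \<open>\<psi>' = 1 / h' \<circ> \<psi>\<close>.
\<close>

lemma ex_C2_inverse:
  fixes h :: "real \<Rightarrow> real"
  assumes D: "\<And>t. (h has_real_derivative h' t) (at t)" and C: "C_k 1 h'"
    and e: "e > 0" "\<And>t. h' t \<ge> e"
  obtains \<psi> where "C_k 2 \<psi>" "\<And>t. h (\<psi> t) = t" "\<And>t. \<psi> (h t) = t"
proof -
  have cont: "continuous_on A h" for A
    using D by (meson DERIV_isCont continuous_at_imp_continuous_on)
  have slope: "e * (y - x) \<le> h y - h x" if "x \<le> y" for x y
  proof -
    have "h x - e * x \<le> h y - e * y"
    proof (rule DERIV_nonneg_imp_nondecreasing[OF that])
      fix z
      have "((\<lambda>x. h x - e * x) has_real_derivative h' z - e) (at z)"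
        by (auto intro!: derivative_eq_intros D)
      then show "\<exists>y. ((\<lambda>x. h x - e * x) has_real_derivative y) (at z) \<and> 0 \<le> y"
        using e(2)[of z] by (intro exI conjI) auto
    qed
    then show ?thesis by (simp add: algebra_simps)
  qed
  have abs_slope: "e * \<bar>y - x\<bar> \<le> \<bar>h y - h x\<bar>" for x y
  proof (cases "x \<le> y")
    case True
    then show ?thesis using slope[of x y] by simp
  next
    case False
    then show ?thesis using slope[of y x] by simp
  qed
  have "\<exists>x. h x = y" for y
  proof -
    define r where "r = \<bar>y - h 0\<bar> / e"
    have r: "r \<ge> 0" "e * r = \<bar>y - h 0\<bar>" using e by (auto simp: r_def)
    have "h (- r) \<le> y" "y \<le> h r"
      using slope[of "- r" 0] slope[of 0 r] r by auto
    then show ?thesis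
      using IVT'[of h "- r" y r] r(1) cont by auto
  qed
  then obtain \<psi> where \<psi>: "\<And>y. h (\<psi> y) = y" by metis
  have \<psi>h: "\<psi> (h t) = t" for t
  proof -
    have "e * \<bar>\<psi> (h t) - t\<bar> \<le> 0" using abs_slope[of "\<psi> (h t)" t] by (simp add: \<psi>)
    then show ?thesis using e(1) by (simp add: mult_le_0_iff)
  qed
  have "(1 / e)-lipschitz_on UNIV \<psi>"
  proof (rule lipschitz_onI)
    show "dist (\<psi> x) (\<psi> y) \<le> 1 / e * dist x y" for x y
      using abs_slope[of "\<psi> x" "\<psi> y"] by (simp add: \<psi> dist_real_def pos_le_divide_eq[OF e(1)] mult.commute)
  qed (use e in auto)
  then have cont_\<psi>: "continuous_on UNIV \<psi>"
    by (rule lipschitz_on_continuous_on)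
  have h'_nz: "h' t \<noteq> 0" for t using e(1) e(2)[of t] by linarith
  have D\<psi>: "(\<psi> has_real_derivative inverse (h' (\<psi> t))) (at t)" for t
    by (rule has_field_derivative_inverse_basic[where f = h and t = UNIV, OF D h'_nz])
       (use cont_\<psi> \<psi> in \<open>auto simp: continuous_on_eq_continuous_at\<close>)
  have cont_inv: "continuous_on UNIV (\<lambda>t. inverse (h' (\<psi> t)))"
    by (intro continuous_intros continuous_on_compose2[OF C_k_imp_continuous[OF C]] cont_\<psi>)
       (auto simp: h'_nz)
  have "C_k 1 \<psi>" by (rule C_k_1_realI[OF D\<psi> cont_inv])
  then have "C_k 1 (\<lambda>t. h' (\<psi> t))" by (rule C_k_1_compose[OF C])
  then obtain k where k: "\<And>t. ((\<lambda>t. h' (\<psi> t)) has_real_derivative k t) (at t)" "continuous_on UNIV k"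
    unfolding C_k_1_real_iff by blast
  have "((\<lambda>t. inverse (h' (\<psi> t))) has_real_derivative
      - (inverse (h' (\<psi> t)) * k t * inverse (h' (\<psi> t)))) (at t)" for t
    by (rule DERIV_inverse'[OF k(1) h'_nz])
  moreover have "continuous_on UNIV (\<lambda>t. - (inverse (h' (\<psi> t)) * k t * inverse (h' (\<psi> t))))"
    by (intro continuous_intros cont_inv k(2))
  ultimately have "C_k 1 (\<lambda>t. inverse (h' (\<psi> t)))"
    by (rule C_k_1_realI)
  then have "C_k 2 \<psi>"
    by (rule C_k_2I[rotated]) (use D\<psi> in \<open>simp add: has_real_derivative_iff_has_vector_derivative\<close>)
  then show ?thesis using \<psi> \<psi>h by (rule that)
qed

text \<open>
  The square of \<open>\<phi>\<close> is a translation by \<open>m\<close> full turns, and subtracting \<open>j\<close> full turns from \<open>\<phi>\<close>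
  changes \<open>m\<close> to \<open>m - 2j\<close>. If \<open>m\<close> were even, some lift would be an increasing involution of the line,
  hence the identity, and \<open>\<alpha>\<close> would be constant.
\<close>

lemma increasing_reflecting_map_normal_form:
  assumes \<alpha>: "immersed_loop 1 \<alpha>" and refl: "\<And>t. \<alpha> (\<phi> t) = 2 * c - \<alpha> t"
    and D: "\<And>t. (\<phi> has_real_derivative \<phi>' t) (at t)" and pos: "\<And>t. \<phi>' t > 0"
    and d: "\<And>t. \<phi> (t + 2 * pi) = \<phi> t + 2 * pi * of_int d"
    and inv: "\<And>t. [\<phi> (\<phi> t) = t] (rmod (2 * pi))"
  obtains j :: int where "\<And>t. \<phi> (\<phi> t - 2 * pi * of_int j) - 2 * pi * of_int j = t + 2 * pi"
    "\<And>t. \<phi> (t + 2 * pi) = \<phi> t + 2 * pi"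
proof -
  have mono: "\<phi> x < \<phi> y" if "x < y" for x y
    using DERIV_pos_imp_increasing[OF that, of \<phi>] D pos by blast
  have cont: "continuous_on A \<phi>" for A
    using D by (meson DERIV_isCont continuous_at_imp_continuous_on)
  have "continuous_on UNIV (\<lambda>t. \<phi> (\<phi> t))"
    by (intro continuous_on_compose2[OF cont] cont) auto
  then obtain m where m: "\<And>t. \<phi> (\<phi> t) = t + 2 * pi * of_int m"
    using congruent_continuous_imp_differ_by_constant[OF continuous_on_id, of "\<lambda>t. \<phi> (\<phi> t)"] inv rcong_sym
    by (metis id_apply)
  have "d = 1"
  proof -
    have "\<phi> 0 < \<phi> (0 + 2 * pi)" by (rule mono) simp
    then have "d > 0" by (simp only: d) (simp add: zero_less_mult_iff)
    with circle_map_compose_self_degree[OF d m] show ?thesis by auto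
  qed
  then have d: "\<phi> (t + 2 * pi) = \<phi> t + 2 * pi" for t using d by simp
  have shift: "\<phi> (t - 2 * pi * of_int n) = \<phi> t - 2 * pi * of_int n" for t n
    using circle_map_shift[of \<phi> 1 t "- n"] d by simp
  have "odd m"
  proof
    assume "even m"
    then obtain j where j: "m = 2 * j" by (auto elim: evenE)
    define \<phi>0 where "\<phi>0 t = \<phi> t - 2 * pi * of_int j" for t
    have id: "\<phi>0 (\<phi>0 t) = t" for t
      unfolding \<phi>0_def shift m j by (simp add: algebra_simps)
    have "\<phi>0 t = t" for t
    proof (rule linorder_cases[of "\<phi>0 t" t])
      assume "\<phi>0 t < t"
      from mono[OF this] have "\<phi>0 (\<phi>0 t) < \<phi>0 t" by (simp add: \<phi>0_def)
      with id \<open>\<phi>0 t < t\<close> show ?thesis by simp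
    next
      assume "t < \<phi>0 t"
      from mono[OF this] have "\<phi>0 t < \<phi>0 (\<phi>0 t)" by (simp add: \<phi>0_def)
      with id \<open>t < \<phi>0 t\<close> show ?thesis by simp
    qed
    then have "\<phi> t = t + 2 * pi * of_int j" for t
      by (metis \<phi>0_def diff_add_cancel)
    then have "2 * \<alpha> t = 2 * c" for t
      using refl[of t] periodic_shift[of \<alpha> t j] loop_periodic[OF \<alpha>] by simp
    then have "\<alpha> = (\<lambda>t. c)" by auto
    then show False using velocity_nonzero[OF \<alpha>, of 0] by simp
  qed
  then obtain j where j: "m = 2 * j + 1" by (auto elim: oddE)
  show ?thesis
  proof (rule that[of j])
    show "\<phi> (\<phi> t - 2 * pi * of_int j) - 2 * pi * of_int j = t + 2 * pi" for t
      unfolding shift m j by (simp add: algebra_simps)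
  qed (rule d)
qed

lemma diameter_central_if_increasing:
  assumes \<alpha>: "immersed_loop 2 \<alpha>" and refl: "\<And>t. \<alpha> (\<phi> t) = 2 * c - \<alpha> t"
    and D: "\<And>t. (\<phi> has_real_derivative \<phi>' t) (at t)" and pos: "\<And>t. \<phi>' t > 0" and C: "C_k 1 \<phi>'"
    and d: "\<And>t. \<phi> (t + 2 * pi) = \<phi> t + 2 * pi" and sq: "\<And>t. \<phi> (\<phi> t) = t + 2 * pi"
  shows "diameter_central 2 \<alpha> c"
proof -
  \<comment> \<open>Applying \<open>\<phi>\<close> replaces the pair \<open>t, \<phi> t\<close> by \<open>\<phi> t, t + 2\<pi>\<close> and so moves its average by \<open>\<pi>\<close>.\<close>
  define h where "h t = (t + \<phi> t - pi) / 2" for t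
  define h' where "h' t = (1 + \<phi>' t) / 2" for t
  have Dh: "(h has_real_derivative h' t) (at t)" for t
    unfolding h_def h'_def by (auto intro!: derivative_eq_intros D)
  obtain \<phi>'' where \<phi>'': "\<And>t. (\<phi>' has_real_derivative \<phi>'' t) (at t)" "continuous_on UNIV \<phi>''"
    using C unfolding C_k_1_real_iff by blast
  have "(h' has_real_derivative \<phi>'' t / 2) (at t)" for t
    unfolding h'_def by (auto intro!: derivative_eq_intros \<phi>'')
  moreover have "continuous_on UNIV (\<lambda>t. \<phi>'' t / 2)"
    by (intro continuous_intros \<phi>'') auto
  ultimately have Ch': "C_k 1 h'"
    by (rule C_k_1_realI)
  have "h' t \<ge> 1 / 2" for t
    using pos[of t] by (simp add: h'_def)
  then obtain \<psi> where C\<psi>: "C_k 2 \<psi>" and inv: "\<And>t. h (\<psi> t) = t" "\<And>t. \<psi> (h t) = t"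
    using ex_C2_inverse[OF Dh Ch', of "1 / 2"] by auto
  have "C_k 2 h"
    using Dh Ch' by (intro C_k_2I[of h h']) (simp_all add: has_real_derivative_iff_has_vector_derivative)
  have h_shift: "h (t + 2 * pi) = h t + 2 * pi" for t
    unfolding h_def d by (simp add: field_simps)
  have \<psi>_shift: "\<psi> (t + 2 * pi) = \<psi> t + 2 * pi" for t
    using inv(2)[of "\<psi> t + 2 * pi"] by (simp add: h_shift inv(1))
  have h2: "2 * h t = t + \<phi> t - pi" for t
    by (simp add: h_def)
  have h_\<phi>: "h (\<phi> t) = h t + pi" for t
    using h2[of "\<phi> t"] h2[of t] sq[of t] by simp
  have "\<phi> (\<psi> t) = \<psi> (t + pi)" for t
    using inv(2)[of "\<phi> (\<psi> t)"] by (simp add: h_\<phi> inv(1))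
  then have "2 * c - (\<alpha> \<circ> \<psi>) t = (\<alpha> \<circ> \<psi>) (t + pi)" for t
    using refl[of "\<psi> t"] by simp
  moreover have "circle_map 2 h" "circle_map 2 \<psi>"
    unfolding circle_map_def using \<open>C_k 2 h\<close> C\<psi> h_shift \<psi>_shift by (auto intro!: exI[of _ 1])
  then have "circle_diffeo 2 \<psi>"
    unfolding circle_diffeo_def using inv by (metis rcong_refl)
  ultimately show ?thesis
    unfolding diameter_central_def reparametrizes_def by blast
qed

text \<open>
  The velocities satisfy \<open>D \<alpha>' (\<phi> t) = - \<alpha>' t\<close>, so their directions are opposite for \<open>D > 0\<close> and equal
  for \<open>D < 0\<close>.
\<close>

lemma reflecting_map_tangent_angle:
  assumes \<alpha>: "immersed_loop 1 \<alpha>" and refl: "\<And>t. \<alpha> (\<phi> t) = 2 * c - \<alpha> t"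
    and D: "(\<phi> has_real_derivative D) (at t)" and \<theta>: "tangent_angle \<alpha> \<theta>"
  shows "cis (\<theta> (\<phi> t)) = - of_real (sgn D) * cis (\<theta> t)"
proof -
  have "sgn (of_real D * velocity \<alpha> (\<phi> t)) = sgn (- velocity \<alpha> t)"
    by (simp add: reflecting_map_velocity(1)[OF \<alpha> refl D])
  then have eq: "of_real (sgn D) * cis (\<theta> (\<phi> t)) = - cis (\<theta> t)"
    using \<theta> by (simp add: tangent_angle_def sgn_mult sgn_minus sgn_of_real)
  have "D \<noteq> 0" by (rule reflecting_map_velocity(2)[OF \<alpha> refl D])
  then have "complex_of_real (sgn D) * of_real (sgn D) = 1"
    by (simp add: sgn_if)
  then have "cis (\<theta> (\<phi> t)) = of_real (sgn D) * (of_real (sgn D) * cis (\<theta> (\<phi> t)))"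
    by (simp add: mult.assoc[symmetric])
  then show ?thesis by (simp add: eq)
qed

text \<open>
  Since \<open>\<phi>\<close> is increasing, the velocities at \<open>t\<close> and \<open>\<phi> t\<close> have opposite directions, so the tangent angle
  changes by \<open>(2l + 1)\<pi>\<close> from \<open>t\<close> to \<open>\<phi> t\<close>, with \<open>l\<close> independent of \<open>t\<close>, and by twice that over the full
  turn \<open>\<phi> (\<phi> t) = t + 2\<pi>\<close>.
\<close>

lemma turning_number_odd_if_increasing:
  assumes \<alpha>: "immersed_loop 1 \<alpha>" and refl: "\<And>t. \<alpha> (\<phi> t) = 2 * c - \<alpha> t"
    and D: "\<And>t. (\<phi> has_real_derivative \<phi>' t) (at t)" and pos: "\<And>t. \<phi>' t > 0"
    and sq: "\<And>t. \<phi> (\<phi> t) = t + 2 * pi" and n: "has_turning_number \<alpha> n"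
  shows "odd n"
proof -
  obtain \<theta> where \<theta>: "tangent_angle \<alpha> \<theta>" and shift: "\<And>t. \<theta> (t + 2 * pi) = \<theta> t + 2 * pi * of_int n"
    using n unfolding has_turning_number_def by blast
  have cont_\<theta>: "continuous_on UNIV \<theta>" using \<theta> by (simp add: tangent_angle_def)
  have "continuous_on UNIV \<phi>"
    using D by (meson DERIV_isCont continuous_at_imp_continuous_on)
  then have cont: "continuous_on UNIV (\<lambda>t. \<theta> (\<phi> t))" "continuous_on UNIV (\<lambda>t. \<theta> t + pi)"
    by (auto intro!: continuous_intros cont_\<theta> continuous_on_compose2[OF cont_\<theta>])
  have "cis (\<theta> (\<phi> t)) = cis (\<theta> t + pi)" for t
    using reflecting_map_tangent_angle[OF \<alpha> refl D[of t] \<theta>] pos[of t] by (simp flip: cis_mult)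
  then have "[\<theta> t + pi = \<theta> (\<phi> t)] (rmod (2 * pi))" for t
    by (metis cis_eq_iff)
  then obtain l :: int where l: "\<And>t. \<theta> (\<phi> t) = \<theta> t + pi + 2 * pi * of_int l"
    using congruent_continuous_imp_differ_by_constant[OF cont(2,1)] by blast
  have "\<theta> (0 + 2 * pi) = \<theta> 0 + 2 * pi * (1 + 2 * of_int l)"
    using l[of "\<phi> 0"] l[of 0] by (simp add: sq algebra_simps)
  then have "2 * pi * of_int n = 2 * pi * (1 + 2 * real_of_int l)"
    unfolding shift by simp
  then have "real_of_int n = 1 + 2 * real_of_int l" by (simp only: mult_cancel_left) simp
  then have "n = 1 + 2 * l" by linarith
  then show ?thesis by simp
qed

section \<open>Orientation-reversing symmetry\<close>

text \<open>
  Now the velocities at \<open>t\<close> and \<open>\<phi> t\<close> point in the same direction, so \<open>\<theta> \<circ> \<phi>\<close> and \<open>\<theta>\<close> differ by a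
  constant; over one period the first changes by \<open>-2\<pi>n\<close> and the second by \<open>2\<pi>n\<close>.
\<close>

lemma turning_number_zero_if_decreasing:
  assumes \<alpha>: "immersed_loop 1 \<alpha>" and refl: "\<And>t. \<alpha> (\<phi> t) = 2 * c - \<alpha> t"
    and D: "\<And>t. (\<phi> has_real_derivative \<phi>' t) (at t)" and neg: "\<And>t. \<phi>' t < 0"
    and d: "\<And>t. \<phi> (t + 2 * pi) = \<phi> t - 2 * pi" and n: "has_turning_number \<alpha> n"
  shows "n = 0"
proof -
  obtain \<theta> where \<theta>: "tangent_angle \<alpha> \<theta>" and shift: "\<And>t. \<theta> (t + 2 * pi) = \<theta> t + 2 * pi * of_int n"
    using n unfolding has_turning_number_def by blast
  have cont_\<theta>: "continuous_on UNIV \<theta>" using \<theta> by (simp add: tangent_angle_def)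
  have "continuous_on UNIV \<phi>"
    using D by (meson DERIV_isCont continuous_at_imp_continuous_on)
  then have cont: "continuous_on UNIV (\<lambda>t. \<theta> (\<phi> t))"
    by (auto intro!: continuous_on_compose2[OF cont_\<theta>])
  have "cis (\<theta> (\<phi> t)) = cis (\<theta> t)" for t
    using reflecting_map_tangent_angle[OF \<alpha> refl D[of t] \<theta>] neg[of t] by simp
  then have "[\<theta> t = \<theta> (\<phi> t)] (rmod (2 * pi))" for t
    by (metis cis_eq_iff)
  then obtain l :: int where l: "\<And>t. \<theta> (\<phi> t) = \<theta> t + 2 * pi * of_int l"
    using congruent_continuous_imp_differ_by_constant[OF cont_\<theta> cont] by blast
  have "\<theta> (\<phi> 0 - 2 * pi) = \<theta> (0 + 2 * pi) + 2 * pi * of_int l"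
    using l[of "0 + 2 * pi"] by (simp only: d)
  then have "\<theta> (\<phi> 0 - 2 * pi) = \<theta> (\<phi> 0) + 2 * pi * of_int n"
    unfolding shift by (simp add: l)
  moreover have "\<theta> (\<phi> 0) = \<theta> (\<phi> 0 - 2 * pi) + 2 * pi * of_int n"
    using shift[of "\<phi> 0 - 2 * pi"] by simp
  ultimately have "2 * pi * real_of_int n + 2 * pi * of_int n = 0" by linarith
  then show ?thesis by simp
qed

text \<open>
  Over a period \<open>g\<close> takes each value of a half-open interval of length \<open>4\<pi>\<close> once, and such an
  interval contains two multiples of \<open>2\<pi>\<close>.
\<close>

lemma card_level_mod_period:
  fixes g :: "real \<Rightarrow> real"
  assumes cont: "continuous_on UNIV g" and dec: "\<And>x y. x < y \<Longrightarrow> g y < g x"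
    and shift: "\<And>t. g (t + 2 * pi) = g t - 4 * pi"
  shows "card {t \<in> {0..<2 * pi}. \<exists>n::int. g t = 2 * pi * of_int n} = 2"
proof -
  \<comment> \<open>The two multiples in the range are the largest one not above \<open>g 0\<close> and its predecessor.\<close>
  define k where "k = \<lfloor>g 0 / (2 * pi)\<rfloor>"
  have end_point: "g (2 * pi) = g 0 - 4 * pi" using shift[of 0] by simp
  have k: "2 * pi * of_int k \<le> g 0" "g 0 < 2 * pi * of_int k + 2 * pi"
  proof -
    have "of_int k \<le> g 0 / (2 * pi)" "g 0 / (2 * pi) < of_int k + 1"
      unfolding k_def by linarith+
    then show "2 * pi * of_int k \<le> g 0" "g 0 < 2 * pi * of_int k + 2 * pi"
      by (simp_all add: field_simps)
  qed
  have "\<exists>t\<in>{0..<2 * pi}. g t = y" if "y \<le> g 0" "g 0 - 4 * pi < y" for y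
  proof -
    have "\<exists>t. 0 \<le> t \<and> t \<le> 2 * pi \<and> g t = y"
      by (rule IVT2') (use that end_point continuous_on_subset[OF cont] in auto)
    then obtain t where t: "0 \<le> t" "t \<le> 2 * pi" "g t = y" by blast
    moreover have "t \<noteq> 2 * pi" using that(2) t(3) end_point by auto
    ultimately show ?thesis by (intro bexI[of _ t]) auto
  qed
  moreover have "2 * pi * (of_int k - 1) \<le> g 0" "g 0 - 4 * pi < 2 * pi * (of_int k - 1)"
    "g 0 - 4 * pi < 2 * pi * of_int k"
    using k by (simp_all add: algebra_simps)
  ultimately obtain t1 t2 where t: "t1 \<in> {0..<2 * pi}" "g t1 = 2 * pi * of_int k"
    "t2 \<in> {0..<2 * pi}" "g t2 = 2 * pi * (of_int k - 1)"
    using k(1) by metis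
  have inj: "x = y" if "g x = g y" for x y
    using dec that by (metis less_irrefl linorder_less_linear)
  have "t = t1 \<or> t = t2" if "t \<in> {0..<2 * pi}" "g t = 2 * pi * of_int n" for t and n :: int
  proof -
    have "g t \<le> g 0" "g (2 * pi) < g t"
      using that(1) dec[of 0 t] dec[of t "2 * pi"] by (cases "t = 0"; auto)+
    then have "2 * pi * of_int n < 2 * pi * (of_int k + 1)" "2 * pi * (of_int k - 2) < 2 * pi * of_int n"
      using k end_point that(2) by (simp_all add: algebra_simps)
    then have "real_of_int n < of_int k + 1" "of_int k - 2 < real_of_int n"
      using mult_less_cancel_left_pos[of "2 * pi" "real_of_int n" "of_int k + 1"]
        mult_less_cancel_left_pos[of "2 * pi" "of_int k - 2" "real_of_int n"] by simp_all
    then have "n = k \<or> n = k - 1" by linarith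
    then show ?thesis using that(2) t inj by auto
  qed
  moreover have "g t2 = 2 * pi * of_int (k - 1)" using t(4) by simp
  ultimately have "{t \<in> {0..<2 * pi}. \<exists>n::int. g t = 2 * pi * of_int n} = {t1, t2}"
    using t by blast
  moreover have "t1 \<noteq> t2" using t by auto
  ultimately show ?thesis by simp
qed

text \<open>
  The loop passes through the center exactly at the fixed points of the reflecting map on the
  circle: elsewhere a passage would be tangential to a second one. A decreasing map \<open>\<phi>\<close> of degree
  \<open>-1\<close> has two of them, because \<open>\<phi> t - t\<close> decreases by two full turns in one period.
\<close>

lemma simple_double_point_if_decreasing:
  assumes \<alpha>: "immersed_loop 1 \<alpha>" and cl: "clean \<alpha>" and refl: "\<And>t. \<alpha> (\<phi> t) = 2 * c - \<alpha> t"
    and D: "\<And>t. (\<phi> has_real_derivative \<phi>' t) (at t)" and neg: "\<And>t. \<phi>' t < 0"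
    and d: "\<And>t. \<phi> (t + 2 * pi) = \<phi> t - 2 * pi"
  shows "simple_double_point \<alpha> c"
proof -
  have "\<alpha> t = c \<longleftrightarrow> (\<exists>n::int. \<phi> t - t = 2 * pi * of_int n)" for t
  proof
    assume c: "\<alpha> t = c"
    have "[t = \<phi> t] (rmod (2 * pi))"
    proof (rule clean_parallel_imp_same_parameter[OF cl])
      show "\<alpha> t = \<alpha> (\<phi> t)" by (simp add: refl c)
      have "velocity \<alpha> t / velocity \<alpha> (\<phi> t) = of_real (- \<phi>' t)"
        using reflecting_map_velocity(3)[OF \<alpha> refl D[of t]] by simp (metis minus_minus)
      then show "velocity \<alpha> t / velocity \<alpha> (\<phi> t) \<in> \<real>" by (metis Reals_of_real)
    qed (rule velocity_nonzero[OF \<alpha>])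
    then show "\<exists>n::int. \<phi> t - t = 2 * pi * of_int n"
      by (auto simp: rcong_altdef)
  next
    assume "\<exists>n::int. \<phi> t - t = 2 * pi * of_int n"
    then obtain n :: int where "\<phi> t = t + 2 * pi * of_int n" by (auto simp: algebra_simps)
    then have "\<alpha> t = 2 * c - \<alpha> t"
      using refl[of t] periodic_shift[of \<alpha> t n] loop_periodic[OF \<alpha>] by simp
    then have "2 * \<alpha> t = 2 * c" by (simp add: algebra_simps)
    then show "\<alpha> t = c" by simp
  qed
  moreover have "card {t \<in> {0..<2 * pi}. \<exists>n::int. \<phi> t - t = 2 * pi * of_int n} = 2"
  proof (rule card_level_mod_period)
    show "continuous_on UNIV (\<lambda>t. \<phi> t - t)"
      using D by (intro continuous_intros) (meson DERIV_isCont continuous_at_imp_continuous_on)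
    show "\<phi> y - y < \<phi> x - x" if "x < y" for x y
      using DERIV_neg_imp_decreasing[OF that, of \<phi>] D neg that by fastforce
  qed (simp add: d)
  ultimately show ?thesis
    by (simp add: simple_double_point_def)
qed

section \<open>The model loops\<close>

lemma exp_loop:
  fixes m :: int
  assumes "m \<noteq> 0"
  defines "\<epsilon> \<equiv> (\<lambda>\<theta>. exp (of_int m * \<i> * complex_of_real \<theta>))"
  shows "immersed_loop 1 \<epsilon>" "has_turning_number \<epsilon> m"
proof -
  have eq: "\<epsilon> t = cis (of_int m * t)" for t
    by (simp add: \<epsilon>_def cis_conv_exp mult_ac)
  have D: "(\<epsilon> has_vector_derivative of_int m * \<i> * \<epsilon> t) (at t)" for t
    unfolding \<epsilon>_def by (rule has_vector_derivative_real_field) (auto intro!: derivative_eq_intros)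
  then have vel: "velocity \<epsilon> t = of_int m * \<i> * \<epsilon> t" for t
    by (rule vector_derivative_at)
  have per: "\<epsilon> (t + 2 * pi) = \<epsilon> t" for t
  proof -
    have "cis (2 * pi * of_int m) = 1" by (rule cis_multiple_2pi) auto
    then show ?thesis by (simp add: eq distrib_left mult_ac flip: cis_mult)
  qed
  have "continuous_on UNIV (\<lambda>t. of_int m * \<i> * \<epsilon> t)"
    unfolding \<epsilon>_def by (intro continuous_intros)
  moreover have "velocity \<epsilon> t \<noteq> 0" for t
    unfolding vel using assms(1) by (simp add: eq)
  ultimately show "immersed_loop 1 \<epsilon>"
    unfolding immersed_loop_def C_k_1_iff using D per
    by (auto intro!: exI[of _ "\<lambda>t. of_int m * \<i> * \<epsilon> t"])
  \<comment> \<open>The velocity is the radius vector, turned by a right angle to the side given by the sign of \<open>m\<close>.\<close>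
  define \<theta> where "\<theta> t = of_int m * t + of_int (sgn m) * pi / 2" for t :: real
  have "sgn (velocity \<epsilon> t) = cis (\<theta> t)" for t
  proof -
    have "sgn (velocity \<epsilon> t) = of_real (sgn (of_int m)) * \<i> * cis (of_int m * t)"
    proof -
      have "sgn (complex_of_int m) = of_real (sgn (of_int m))"
        using sgn_of_real[of "of_int m"] by simp
      moreover have "sgn \<i> = \<i>" "sgn (cis x) = cis x" for x
        by (simp_all add: sgn_eq)
      ultimately show ?thesis by (simp only: vel eq sgn_mult)
    qed
    also have "of_real (sgn (of_int m)) * \<i> = cis (of_int (sgn m) * pi / 2)"
      using assms(1) by (cases "m > 0") (auto simp: complex_eq_iff)
    finally show ?thesis by (simp add: \<theta>_def cis_mult add.commute)
  qed
  moreover have "continuous_on UNIV \<theta>"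
    unfolding \<theta>_def by (intro continuous_intros)
  ultimately show "has_turning_number \<epsilon> m"
    unfolding has_turning_number_def tangent_angle_def
    by (intro exI[of _ \<theta>]) (simp add: \<theta>_def algebra_simps)
qed

text \<open>
  The turning number is read off from the reflection \<open>t \<mapsto> \<pi> - t\<close>, a decreasing one, instead of
  from an explicit tangent angle.
\<close>

lemma figure_eight_loop: "immersed_loop 1 figure_eight" "has_turning_number figure_eight 0"
proof -
  define v where "v t = Complex (- sin t) (2 * cos (2 * t))" for t
  have D: "(figure_eight has_vector_derivative v t) (at t)" for t
    unfolding has_vector_derivative_complex_iff figure_eight_def v_def
    by (auto intro!: derivative_eq_intros)
  then have vel: "velocity figure_eight t = v t" for t
    by (rule vector_derivative_at)
  have nz: "v t \<noteq> 0" for t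
  proof
    assume "v t = 0"
    then have "sin t = 0" "cos (2 * t) = 0" by (auto simp: v_def complex_eq_iff)
    then show False by (simp add: cos_double_sin)
  qed
  have "continuous_on UNIV v"
    unfolding v_def Complex_eq by (intro continuous_intros)
  moreover have "figure_eight (t + 2 * pi) = figure_eight t" for t
  proof -
    have "2 * (t + 2 * pi) = (2 * t + 2 * pi) + 2 * pi" by simp
    then have "sin (2 * (t + 2 * pi)) = sin (2 * t)" by (simp only: sin_periodic)
    then show ?thesis by (simp add: figure_eight_def)
  qed
  ultimately show im: "immersed_loop 1 figure_eight"
    unfolding immersed_loop_def C_k_1_iff using D vel nz by auto
  have refl: "figure_eight (pi - t) = 2 * 0 - figure_eight t" for t
    using sin_periodic[of "- (2 * t)"] by (simp add: figure_eight_def complex_eq_iff algebra_simps)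
  obtain n where n: "has_turning_number figure_eight n"
    using ex_turning_number[OF im] by blast
  have "n = 0"
    by (rule turning_number_zero_if_decreasing[OF im refl, where \<phi>' = "\<lambda>_. - 1"])
       (auto intro!: derivative_eq_intros n)
  with n show "has_turning_number figure_eight 0" by simp
qed

section \<open>Clean central loops\<close>

theorem proposition2p16:
  fixes \<alpha> :: "real \<Rightarrow> complex" and c :: complex
  assumes "immersed_loop 2 \<alpha>"
    and "clean \<alpha>"
    and "central \<alpha> c"
  shows "((symmetry_preserves_orientation 2 \<alpha> c \<and>
           (\<exists>k::int. regularly_homotopic \<alpha>
              (\<lambda>\<theta>. exp (of_int (2 * k + 1) * \<i> * complex_of_real \<theta>))) \<and>
           c \<notin> range \<alpha> \<and>
           diameter_central 2 \<alpha> c) \<or>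
          (symmetry_reverses_orientation 2 \<alpha> c \<and>
           regularly_homotopic \<alpha> figure_eight \<and>
           simple_double_point \<alpha> c \<and>
           \<not> diameter_central 2 \<alpha> c)) \<and>
         \<not> (symmetry_preserves_orientation 2 \<alpha> c \<and> symmetry_reverses_orientation 2 \<alpha> c)"
proof -
  note \<alpha> = immersed_loop_2_imp_1[OF assms(1)]
  obtain \<phi> \<phi>' where diffeo: "circle_diffeo 2 \<phi>" and refl: "\<And>t. \<alpha> (\<phi> t) = 2 * c - \<alpha> t"
    and D: "\<And>t. (\<phi> has_real_derivative \<phi>' t) (at t)" and C: "C_k 1 \<phi>'"
    and inv: "\<And>t. [\<phi> (\<phi> t) = t] (rmod (2 * pi))"
    using ex_reflecting_diffeo[OF assms] by blast
  obtain d where d: "\<And>t. \<phi> (t + 2 * pi) = \<phi> t + 2 * pi * of_int d"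
    using diffeo unfolding circle_diffeo_def circle_map_def by blast
  have comp: "(\<lambda>t. 2 * c - \<alpha> t) = \<alpha> \<circ> \<phi>" by (auto simp: refl)
  have deriv: "deriv \<phi> t = \<phi>' t" for t using D by (rule DERIV_imp_deriv)
  have cont: "continuous_on A \<phi>" for A
    using D by (meson DERIV_isCont continuous_at_imp_continuous_on)
  obtain n where n: "has_turning_number \<alpha> n"
    using ex_turning_number[OF \<alpha>] by blast
  have "\<phi>' t \<noteq> 0" for t by (rule reflecting_map_velocity(2)[OF \<alpha> refl D])
  then consider (pos) "\<And>t. \<phi>' t > 0" | (neg) "\<And>t. \<phi>' t < 0"
    using continuous_nonzero_sign[OF C_k_imp_continuous[OF C]] by blast
  then have "(symmetry_preserves_orientation 2 \<alpha> c \<and>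
           (\<exists>k::int. regularly_homotopic \<alpha>
              (\<lambda>\<theta>. exp (of_int (2 * k + 1) * \<i> * complex_of_real \<theta>))) \<and>
           c \<notin> range \<alpha> \<and>
           diameter_central 2 \<alpha> c) \<or>
          (symmetry_reverses_orientation 2 \<alpha> c \<and>
           regularly_homotopic \<alpha> figure_eight \<and>
           simple_double_point \<alpha> c \<and>
           \<not> diameter_central 2 \<alpha> c)"
  proof cases
    case pos
    have "symmetry_preserves_orientation 2 \<alpha> c"
      unfolding symmetry_preserves_orientation_def preserves_orientation_def
      using diffeo comp pos deriv by auto
    moreover obtain j :: int where sq: "\<And>t. \<phi> (\<phi> t - 2 * pi * of_int j) - 2 * pi * of_int j = t + 2 * pi"
      and d1: "\<And>t. \<phi> (t + 2 * pi) = \<phi> t + 2 * pi"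
      using increasing_reflecting_map_normal_form[OF \<alpha> refl D pos d inv] by blast
    define \<phi>0 where "\<phi>0 t = \<phi> t - 2 * pi * of_int j" for t
    have refl0: "\<alpha> (\<phi>0 t) = 2 * c - \<alpha> t" for t
      using periodic_shift[of \<alpha> "\<phi> t" "- j"] loop_periodic[OF \<alpha>] refl by (simp add: \<phi>0_def)
    have D0: "(\<phi>0 has_real_derivative \<phi>' t) (at t)" for t
      unfolding \<phi>0_def by (auto intro!: derivative_eq_intros D)
    have sq0: "\<phi>0 (\<phi>0 t) = t + 2 * pi" for t using sq by (simp add: \<phi>0_def)
    have dc: "diameter_central 2 \<alpha> c"
      using diameter_central_if_increasing[OF assms(1) refl0 D0 pos C _ sq0] d1 by (simp add: \<phi>0_def)
    moreover have "odd n"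
      by (rule turning_number_odd_if_increasing[OF \<alpha> refl0 D0 pos sq0 n])
    then obtain k where k: "n = 2 * k + 1" by (auto elim: oddE)
    have "regularly_homotopic \<alpha> (\<lambda>\<theta>. exp (of_int (2 * k + 1) * \<i> * complex_of_real \<theta>))"
    proof (rule same_turning_number_imp_regularly_homotopic[OF \<alpha> n])
      have "2 * k + 1 \<noteq> 0" by presburger
      from exp_loop[OF this] show
        "immersed_loop 1 (\<lambda>\<theta>. exp (of_int (2 * k + 1) * \<i> * complex_of_real \<theta>))"
        "has_turning_number (\<lambda>\<theta>. exp (of_int (2 * k + 1) * \<i> * complex_of_real \<theta>)) n"
        unfolding k by blast+
    qed
    ultimately show ?thesis
      using diameter_central_avoids_center[OF assms(1,2)] by blast
  next
    case neg
    have "symmetry_reverses_orientation 2 \<alpha> c"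
      unfolding symmetry_reverses_orientation_def reverses_orientation_def
      using diffeo comp neg deriv by auto
    moreover have "d = - 1"
    proof -
      have "continuous_on UNIV (\<lambda>t. \<phi> (\<phi> t))"
        by (intro continuous_on_compose2[OF cont] cont) auto
      then obtain m where m: "\<And>t. \<phi> (\<phi> t) = t + 2 * pi * of_int m"
        using congruent_continuous_imp_differ_by_constant[OF continuous_on_id, of "\<lambda>t. \<phi> (\<phi> t)"] inv rcong_sym
        by (metis id_apply)
      have "\<phi> (0 + 2 * pi) < \<phi> 0"
        using DERIV_neg_imp_decreasing[of 0 "0 + 2 * pi" \<phi>] D neg by fastforce
      then have "d < 0" by (simp only: d) (simp add: mult_less_0_iff)
      with circle_map_compose_self_degree[OF d m] show ?thesis by auto
    qed
    then have d: "\<phi> (t + 2 * pi) = \<phi> t - 2 * pi" for t using d by simp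
    have "n = 0"
      by (rule turning_number_zero_if_decreasing[OF \<alpha> refl D neg d n])
    then have "regularly_homotopic \<alpha> figure_eight"
      using same_turning_number_imp_regularly_homotopic[OF \<alpha> n] figure_eight_loop by simp
    moreover have double: "simple_double_point \<alpha> c"
      by (rule simple_double_point_if_decreasing[OF \<alpha> assms(2) refl D neg d])
    moreover have "c \<in> range \<alpha>"
    proof -
      have "{t \<in> {0..<2 * pi}. \<alpha> t = c} \<noteq> {}"
        using double unfolding simple_double_point_def by (metis card.empty zero_neq_numeral)
      then show ?thesis by blast
    qed
    ultimately show ?thesis
      using diameter_central_avoids_center[OF assms(1,2)] by blast
  qed
  moreover have False
    if "symmetry_preserves_orientation 2 \<alpha> c" "symmetry_reverses_orientation 2 \<alpha> c"
  proof -
    have same: "deriv \<eta> 0 = \<phi>' 0" if \<eta>: "circle_diffeo 2 \<eta>" "(\<lambda>t. 2 * c - \<alpha> t) = \<alpha> \<circ> \<eta>" for \<eta>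
    proof -
      obtain \<eta>' where "\<And>t. (\<eta> has_vector_derivative \<eta>' t) (at t)" "\<And>t. \<eta>' t \<noteq> 0"
        using circle_diffeo_derivative_nonzero[OF \<eta>(1)] by auto
      then have \<eta>': "(\<eta> has_real_derivative \<eta>' t) (at t)" for t
        by (simp add: has_real_derivative_iff_has_vector_derivative)
      have "\<alpha> (\<eta> t) = 2 * c - \<alpha> t" for t using \<eta>(2) by (metis comp_apply)
      then have "\<eta>' 0 = \<phi>' 0"
        using reflecting_maps_same_derivative[OF \<alpha> assms(2) _ refl \<eta>' D] by blast
      then show ?thesis using DERIV_imp_deriv[OF \<eta>'] by simp
    qed
    show False
      using that unfolding symmetry_preserves_orientation_def symmetry_reverses_orientation_def
        preserves_orientation_def reverses_orientation_def by (metis same less_asym)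
  qed
  ultimately show ?thesis by blast
qed

end
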